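(* Let $\mathfrak{A},\mathfrak{B}$ be unital $C^*$-algebras, let $N\in\mathfrak{A}$ be a normal element whose spectrum $\sigma(N)$ is a Lavrentieff set, and let $A\in\mathfrak{B}$. Suppose $\|p(N)\|=\|p(A)\|$ for every complex polynomial $p$ (norms being the $C^*$-norms of $\mathfrak{A}$ and $\mathfrak{B}$ respectively). Then $A$ is normal.
   Context: A compact set $K\subseteq\mathbb{C}$ is a Lavrentieff set if $\mathbb{C}\setminus K$ is connected and $K$ has empty interior. *)

theory Defs
  imports "HOL-Analysis.Analysis" "HOL-Computational_Algebra.Polynomial"
begin

text \<open>A unital C*-algebra is modelled on a type of class
  real_normed_algebra_1 and banach (complete, norm 1 = 1, submultiplicative norm),
  together with an explicit complex scalar multiplication sc (compatible with
  the real one) and an involution st.\<close>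

definition complex_scalars :: "(complex \<Rightarrow> 'a::real_normed_algebra_1 \<Rightarrow> 'a) \<Rightarrow> bool" where
  "complex_scalars sc \<longleftrightarrow>
     (\<forall>r x. sc (complex_of_real r) x = r *\<^sub>R x) \<and>
     (\<forall>a x y. sc a (x + y) = sc a x + sc a y) \<and>
     (\<forall>a b x. sc (a + b) x = sc a x + sc b x) \<and>
     (\<forall>a b x. sc a (sc b x) = sc (a * b) x) \<and>
     (\<forall>a x y. sc a (x * y) = sc a x * y) \<and>
     (\<forall>a x y. sc a (x * y) = x * sc a y) \<and>
     (\<forall>a x. norm (sc a x) = cmod a * norm x)"

definition unital_cstar_algebra ::
  "(complex \<Rightarrow> 'a::{real_normed_algebra_1,banach} \<Rightarrow> 'a) \<Rightarrow> ('a \<Rightarrow> 'a) \<Rightarrow> bool" where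
  "unital_cstar_algebra sc st \<longleftrightarrow>
     complex_scalars sc \<and>
     (\<forall>x. st (st x) = x) \<and>
     (\<forall>x y. st (x + y) = st x + st y) \<and>
     (\<forall>a x. st (sc a x) = sc (cnj a) (st x)) \<and>
     (\<forall>x y. st (x * y) = st y * st x) \<and>
     (\<forall>x. norm (st x * x) = (norm x)\<^sup>2)"

definition invertible_elem :: "'a::ring_1 \<Rightarrow> bool" where
  "invertible_elem x \<longleftrightarrow> (\<exists>y. x * y = 1 \<and> y * x = 1)"

definition spec_elem :: "(complex \<Rightarrow> 'a::real_normed_algebra_1 \<Rightarrow> 'a) \<Rightarrow> 'a \<Rightarrow> complex set" where
  "spec_elem sc x = {z. \<not> invertible_elem (x - sc z 1)}"

definition normal_elem :: "('a::ring_1 \<Rightarrow> 'a) \<Rightarrow> 'a \<Rightarrow> bool" where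
  "normal_elem st x \<longleftrightarrow> st x * x = x * st x"

definition poly_eval :: "(complex \<Rightarrow> 'a::real_normed_algebra_1 \<Rightarrow> 'a) \<Rightarrow> complex poly \<Rightarrow> 'a \<Rightarrow> 'a" where
  "poly_eval sc p x = (\<Sum>k\<le>degree p. sc (coeff p k) (x ^ k))"

definition lavrentieff :: "complex set \<Rightarrow> bool" where
  "lavrentieff K \<longleftrightarrow> compact K \<and> connected (- K) \<and> interior K = {}"

end

theory Submission
  imports Defs "HOL-Complex_Analysis.Complex_Analysis" "HOL-Real_Asymp.Real_Asymp"
    "HOL-Computational_Algebra.Fundamental_Theorem_Algebra"
begin

text \<open>Let \<open>K\<close> be the spectrum of \<open>N\<close>. By a special case of Lavrentieff's theorem there are polynomials \<open>p\<^sub>n\<close>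
  converging to \<open>cnj\<close> uniformly on \<open>K\<close>. For normal \<open>N\<close> the norm of \<open>p(N)\<close> is at most the supremum of
  \<open>\<bar>p\<bar>\<close> over \<open>K\<close>, so the elements \<open>p\<^sub>n(A)\<close> converge to some \<open>B\<close> commuting with \<open>A\<close>, and for \<open>T = A + B\<close> and
  \<open>T = \<i> (B - A)\<close>, which correspond to real functions on \<open>K\<close>, the norm of \<open>1 + \<i> t T\<close> is
  \<open>1 + O(t\<^sup>2)\<close>. This forces \<open>T\<close> to be self-adjoint, whence \<open>B\<close> is the adjoint of \<open>A\<close>.

  For the approximation of \<open>cnj\<close>, cut a large square into squares \<open>S\<close> of side \<open>d\<close>. The integrals of
  \<open>cnj (\<zeta> - z) / (\<zeta> - z)\<close> along the boundaries of the \<open>S\<close> add up to a holomorphic function of \<open>z\<close> minus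
  \<open>2 \<pi> \<i> cnj z\<close>. The integral for a square with centre \<open>c\<close> is bounded by \<open>4 d\<close> and asymptotic to
  \<open>2 \<i> d\<^sup>2 / (c - z)\<close>. Near \<open>c\<close> there is an arc of diameter comparable to \<open>d\<close> avoiding \<open>K\<close>, and
  an explicit algebraic function with branch cut along this arc is a uniform limit of polynomials on \<open>K\<close>, is
  \<open>O(1 / d)\<close> and agrees with \<open>1 / (z - c)\<close> to first order; the total error is \<open>O(d log\<^sup>2 d)\<close>.\<close>

subsection \<open>Uniform limits of polynomials\<close>

text \<open>This is the algebra usually written P(K). Members may take any values off
  \<open>K\<close>, so total functions such as \<open>inverse\<close> and \<open>csqrt\<close> can
  be used without restricting them.\<close>

definition poly_closure :: "complex set \<Rightarrow> (complex \<Rightarrow> complex) set" where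
  "poly_closure K = {f. \<forall>e>0. \<exists>p. \<forall>z\<in>K. cmod (f z - poly p z) < e}"

lemma poly_closureD:
  assumes "f \<in> poly_closure K" "e > 0"
  obtains p where "\<And>z. z \<in> K \<Longrightarrow> cmod (f z - poly p z) < e"
  using assms unfolding poly_closure_def by blast

lemma poly_in_poly_closure: "poly p \<in> poly_closure K"
  unfolding poly_closure_def by (auto intro: exI[of _ p])

lemma poly_closure_uniform_limit:
  assumes "\<And>e. e > 0 \<Longrightarrow> \<exists>g\<in>poly_closure K. \<forall>z\<in>K. cmod (f z - g z) < e"
  shows "f \<in> poly_closure K"
  unfolding poly_closure_def
proof (intro CollectI allI impI)
  fix e :: real assume "e > 0"
  then obtain g where g: "g \<in> poly_closure K" "\<forall>z\<in>K. cmod (f z - g z) < e/2"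
    using assms[of "e/2"] by auto
  obtain p where p: "\<And>z. z \<in> K \<Longrightarrow> cmod (g z - poly p z) < e/2"
    using poly_closureD[OF g(1)] \<open>e > 0\<close> by (metis half_gt_zero)
  have "cmod (f z - poly p z) < e" if "z \<in> K" for z
    using norm_triangle_ineq[of "f z - g z" "g z - poly p z"] g(2) p[OF that] that by fastforce
  then show "\<exists>p. \<forall>z\<in>K. cmod (f z - poly p z) < e" by blast
qed

lemma poly_closure_cong:
  assumes "f \<in> poly_closure K" "\<And>z. z \<in> K \<Longrightarrow> g z = f z"
  shows "g \<in> poly_closure K"
  using assms unfolding poly_closure_def by auto

lemma poly_closure_const: "(\<lambda>z. c) \<in> poly_closure K"
  by (rule poly_closure_cong[OF poly_in_poly_closure[of "[:c:]"]]) simp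

lemma poly_closure_ident: "(\<lambda>z. z) \<in> poly_closure K"
  by (rule poly_closure_cong[OF poly_in_poly_closure[of "[:0, 1:]"]]) simp

lemma poly_closure_add:
  assumes "f \<in> poly_closure K" "g \<in> poly_closure K"
  shows "(\<lambda>z. f z + g z) \<in> poly_closure K"
proof (rule poly_closure_uniform_limit)
  fix e :: real assume "e > 0"
  obtain p where p: "\<And>z. z \<in> K \<Longrightarrow> cmod (f z - poly p z) < e/2"
    using poly_closureD[OF assms(1)] \<open>e > 0\<close> by (metis half_gt_zero)
  obtain q where q: "\<And>z. z \<in> K \<Longrightarrow> cmod (g z - poly q z) < e/2"
    using poly_closureD[OF assms(2)] \<open>e > 0\<close> by (metis half_gt_zero)
  have "cmod (f z + g z - poly (p + q) z) < e" if "z \<in> K" for z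
    using norm_triangle_ineq[of "f z - poly p z" "g z - poly q z"] p[OF that] q[OF that]
    by (simp add: algebra_simps)
  then show "\<exists>g'\<in>poly_closure K. \<forall>z\<in>K. cmod (f z + g z - g' z) < e"
    using poly_in_poly_closure by blast
qed

lemma poly_closure_bounded:
  assumes "f \<in> poly_closure K" "bounded K"
  obtains M where "M > 0" "\<And>z. z \<in> K \<Longrightarrow> cmod (f z) \<le> M"
proof -
  obtain p where p: "\<And>z. z \<in> K \<Longrightarrow> cmod (f z - poly p z) < 1"
    using poly_closureD[OF assms(1)] by (metis zero_less_one)
  have "bounded (poly p ` closure K)"
    by (intro compact_imp_bounded compact_continuous_image continuous_intros)
       (use assms in \<open>auto simp: compact_closure\<close>)
  then obtain M where M: "M > 0" "\<And>z. z \<in> closure K \<Longrightarrow> cmod (poly p z) \<le> M"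
    unfolding bounded_pos by auto
  have "cmod (f z) \<le> M + 1" if "z \<in> K" for z
    using norm_triangle_ineq[of "f z - poly p z" "poly p z"] p[OF that] M(2)[of z] that closure_subset
    by fastforce
  with M(1) show ?thesis by (intro that[of "M + 1"]) auto
qed

lemma poly_closure_mult:
  assumes K: "bounded K" and "f \<in> poly_closure K" "g \<in> poly_closure K"
  shows "(\<lambda>z. f z * g z) \<in> poly_closure K"
proof (rule poly_closure_uniform_limit)
  fix e :: real assume "e > 0"
  obtain M where M: "M > 0" "\<And>z. z \<in> K \<Longrightarrow> cmod (g z) \<le> M"
    using poly_closure_bounded[OF assms(3) K] by blast
  obtain p where p: "\<And>z. z \<in> K \<Longrightarrow> cmod (f z - poly p z) < e/2/M"
    using poly_closureD[OF assms(2), of "e/2/M"] \<open>e > 0\<close> \<open>M > 0\<close> by (metis half_gt_zero divide_pos_pos)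
  obtain L where L: "L > 0" "\<And>z. z \<in> K \<Longrightarrow> cmod (poly p z) \<le> L"
    using poly_closure_bounded[OF poly_in_poly_closure K] by blast
  \<comment> \<open>The approximation of \<open>g\<close> is chosen after \<open>p\<close>, because
    its tolerance involves the bound \<open>L\<close> of \<open>p\<close> on
    \<open>K\<close>.\<close>
  obtain q where q: "\<And>z. z \<in> K \<Longrightarrow> cmod (g z - poly q z) < e/2/L"
    using poly_closureD[OF assms(3), of "e/2/L"] \<open>e > 0\<close> \<open>L > 0\<close> by (metis half_gt_zero divide_pos_pos)
  have "cmod (f z * g z - poly (p * q) z) < e" if z: "z \<in> K" for z
  proof -
    have "f z * g z - poly (p * q) z = (f z - poly p z) * g z + poly p z * (g z - poly q z)"
      by (simp add: algebra_simps)
    then have "cmod (f z * g z - poly (p * q) z) \<le>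
        cmod (f z - poly p z) * cmod (g z) + cmod (poly p z) * cmod (g z - poly q z)"
      by (metis norm_mult norm_triangle_ineq)
    also have "\<dots> \<le> cmod (f z - poly p z) * M + L * cmod (g z - poly q z)"
      using M L z by (intro add_mono mult_mono) auto
    also have "\<dots> < e/2/M * M + L * (e/2/L)"
      using p[OF z] q[OF z] M(1) L(1) by (intro add_strict_mono mult_strict_right_mono mult_strict_left_mono) auto
    also have "\<dots> = e" using M(1) L(1) by simp
    finally show ?thesis .
  qed
  then show "\<exists>g'\<in>poly_closure K. \<forall>z\<in>K. cmod (f z * g z - g' z) < e"
    using poly_in_poly_closure by blast
qed

lemma poly_closure_power:
  assumes "bounded K" "f \<in> poly_closure K"
  shows "(\<lambda>z. f z ^ n) \<in> poly_closure K"
  by (induction n) (use assms in \<open>auto intro: poly_closure_const poly_closure_mult\<close>)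

lemma poly_closure_sum:
  assumes "\<And>i. i \<in> I \<Longrightarrow> f i \<in> poly_closure K"
  shows "(\<lambda>z. \<Sum>i\<in>I. f i z) \<in> poly_closure K"
  using assms
  by (induction I rule: infinite_finite_induct) (auto intro: poly_closure_const poly_closure_add)

text \<open>The Taylor series of \<open>h\<close> at 0 converges uniformly on the closed disc of
  radius \<open>\<rho>\<close>, and substituting \<open>x\<close> into a partial sum stays in the
  algebra.\<close>

lemma poly_closure_compose_holomorphic:
  assumes K: "bounded K" and x: "x \<in> poly_closure K"
    and h: "h holomorphic_on ball 0 r" and \<rho>: "\<rho> < r" "\<And>z. z \<in> K \<Longrightarrow> cmod (x z) \<le> \<rho>"
  shows "(\<lambda>z. h (x z)) \<in> poly_closure K"
proof (cases "K = {}")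
  case True
  then show ?thesis by (auto simp: poly_closure_def)
next
  case False
  then have "\<rho> \<ge> 0" using \<rho>(2) by (metis ex_in_conv norm_ge_zero order_trans)
  define a where "a n = (deriv ^^ n) h 0 / fact n" for n
  have sums: "(\<lambda>n. a n * w ^ n) sums h w" if "w \<in> ball 0 r" for w
    using holomorphic_power_series[OF h that] by (simp add: a_def)
  \<comment> \<open>Summability at \<open>r'\<close> only gives
    \<open>r' \<le> conv_radius a\<close>; choosing \<open>r'\<close> strictly above
    \<open>\<rho>\<close> yields the strict inequality that uniform convergence requires.\<close>
  define r' where "r' = (\<rho> + r) / 2"
  have r': "\<rho> < r'" "r' < r" "0 < r'" using \<rho>(1) \<open>\<rho> \<ge> 0\<close> by (auto simp: r'_def)
  have "summable (\<lambda>n. a n * of_real r' ^ n)"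
    using sums[of "of_real r'"] r' by (auto simp: sums_iff)
  then have "ereal r' \<le> conv_radius a"
    using conv_radius_geI[of a "of_real r'"] r' by simp
  then have "ereal \<rho> < conv_radius a" using r' by (metis ereal_less_eq(3) less_le_trans less_ereal.simps(1))
  from powser_uniform_limit[OF this, of 0]
  have lim: "uniform_limit (cball 0 \<rho>) (\<lambda>n w. \<Sum>i<n. a i * w ^ i) (\<lambda>w. suminf (\<lambda>i. a i * w ^ i)) sequentially"
    by simp
  show ?thesis
  proof (rule poly_closure_uniform_limit)
    fix e :: real assume "e > 0"
    from eventually_happens'[OF sequentially_bot uniform_limitD[OF lim this]] obtain n where
      n: "\<forall>w\<in>cball 0 \<rho>. dist (\<Sum>i<n. a i * w ^ i) (suminf (\<lambda>i. a i * w ^ i)) < e"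
      by blast
    have "(\<lambda>z. \<Sum>i<n. a i * x z ^ i) \<in> poly_closure K"
      by (rule poly_closure_sum)
         (rule poly_closure_mult[OF K poly_closure_const poly_closure_power[OF K x]])
    moreover have "cmod (h (x z) - (\<Sum>i<n. a i * x z ^ i)) < e" if "z \<in> K" for z
    proof -
      have "x z \<in> cball 0 \<rho>" "x z \<in> ball 0 r" using \<rho>(1) \<rho>(2)[OF that] by auto
      then show ?thesis using bspec[OF n, of "x z"] sums[of "x z"]
        by (simp add: sums_iff dist_norm norm_minus_commute)
    qed
    ultimately show "\<exists>g\<in>poly_closure K. \<forall>z\<in>K. cmod (h (x z) - g z) < e"
      by (intro bexI[of _ "\<lambda>z. \<Sum>i<n. a i * x z ^ i"] ballI)
  qed
qed

lemma poly_closure_inverse_one_minus: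
  assumes "bounded K" "x \<in> poly_closure K" "\<rho> < 1" "\<And>z. z \<in> K \<Longrightarrow> cmod (x z) \<le> \<rho>"
  shows "(\<lambda>z. inverse (1 - x z)) \<in> poly_closure K"
  by (rule poly_closure_compose_holomorphic[where h = "\<lambda>w. inverse (1 - w)" and r = 1 and \<rho> = \<rho>])
     (use assms in \<open>auto intro!: holomorphic_intros\<close>)

text \<open>One step of moving a pole: 1/(z - b) is expanded as a geometric series in (b - a)/(z -
  a), whose modulus on \<open>K\<close> is at most 1/2.\<close>

lemma poly_closure_inverse_move:
  assumes K: "bounded K" and a: "(\<lambda>z. inverse (z - a)) \<in> poly_closure K"
    and r: "r > 0" "\<And>z. z \<in> K \<Longrightarrow> r \<le> cmod (z - a)" and b: "cmod (b - a) \<le> r/2"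
  shows "(\<lambda>z. inverse (z - b)) \<in> poly_closure K"
proof (rule poly_closure_cong)
  show "(\<lambda>z. inverse (z - a) * inverse (1 - (b - a) * inverse (z - a))) \<in> poly_closure K"
  proof (intro poly_closure_mult poly_closure_inverse_one_minus[where \<rho> = "1/2"] poly_closure_const K a)
    fix z assume z: "z \<in> K"
    have "cmod (b - a) \<le> cmod (z - a) / 2" using b r(2)[OF z] by linarith
    moreover have "cmod (z - a) > 0" using r(1) r(2)[OF z] by linarith
    ultimately show "cmod ((b - a) * inverse (z - a)) \<le> 1/2"
      by (simp add: norm_mult norm_inverse norm_divide field_simps flip: divide_inverse)
  qed auto
next
  fix z assume z: "z \<in> K"
  have "z \<noteq> a" using r(1) r(2)[OF z] by auto
  moreover have "z \<noteq> b" using r(1) r(2)[OF z] b by auto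
  ultimately show "inverse (z - b) = inverse (z - a) * inverse (1 - (b - a) * inverse (z - a))"
    by (simp add: field_simps)
qed

text \<open>Runge's pole pushing. For a pole far from \<open>K\<close> a geometric series in z/b
  suffices; lying in \<open>poly_closure K\<close> is a locally constant property of the pole, and
  \<open>- K\<close> is connected.\<close>

lemma poly_closure_inverse:
  assumes K: "compact K" and conn: "connected (- K)" and a: "a \<notin> K"
  shows "(\<lambda>z. inverse (z - a)) \<in> poly_closure K"
proof -
  have bK: "bounded K" using K compact_imp_bounded by blast
  obtain B where B: "B > 0" "\<And>z. z \<in> K \<Longrightarrow> cmod z \<le> B"
    using bK unfolding bounded_pos by auto
  define b :: complex where "b = of_real (2 * B)"
  have "b \<notin> K" using B(1) B(2)[of b] by (auto simp: b_def)
  have ratio: "cmod (inverse b * z) \<le> 1/2" if "z \<in> K" for z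
  proof -
    have "cmod (inverse b * z) = inverse (2 * B) * cmod z"
      using B(1) by (simp only: b_def norm_mult norm_inverse norm_of_real)
    also have "\<dots> \<le> inverse (2 * B) * B" using B(1) B(2)[OF that] by (intro mult_left_mono) auto
    also have "\<dots> = 1/2" using B(1) by simp
    finally show ?thesis .
  qed
  have "(\<lambda>z. inverse b * z) \<in> poly_closure K"
    by (rule poly_closure_mult[OF bK poly_closure_const poly_closure_ident])
  then have "(\<lambda>z. inverse (1 - inverse b * z)) \<in> poly_closure K"
    by (rule poly_closure_inverse_one_minus[OF bK, where \<rho> = "1/2"]) (use ratio in auto)
  then have "(\<lambda>z. (- inverse b) * inverse (1 - inverse b * z)) \<in> poly_closure K"
    by (rule poly_closure_mult[OF bK poly_closure_const])
  then have bP: "(\<lambda>z. inverse (z - b)) \<in> poly_closure K"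
  proof (rule poly_closure_cong)
    fix z assume z: "z \<in> K"
    have "b \<noteq> 0" using B(1) by (simp add: b_def)
    moreover have "z \<noteq> b" using z \<open>b \<notin> K\<close> by auto
    ultimately show "inverse (z - b) = (- inverse b) * inverse (1 - inverse b * z)"
      by (simp add: field_simps)
  qed
  define R where "R a b \<longleftrightarrow> ((\<lambda>z. inverse (z - a)) \<in> poly_closure K \<longleftrightarrow>
                              (\<lambda>z. inverse (z - b)) \<in> poly_closure K)" for a b
  have "R b a"
  proof (rule connected_equivalence_relation[OF conn, where R = R])
    show "b \<in> - K" "a \<in> - K" using a \<open>b \<notin> K\<close> by auto
  next
    fix a assume "a \<in> - K"
    then obtain r where r: "r > 0" "ball a r \<subseteq> - K"
      using K by (meson compact_imp_closed open_Compl open_contains_ball)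
    have dist: "r \<le> cmod (z - a)" if "z \<in> K" for z
      using r(2) that by (force simp: dist_norm norm_minus_commute)
    \<comment> \<open>Radius \<open>r/4\<close> allows the move in both directions: \<open>K\<close>
      has distance at least \<open>r\<close> from \<open>a\<close> and at least \<open>r/2\<close>
      from \<open>b\<close>, and |b - a| is at most half of either.\<close>
    have "R a b" if "b \<in> ball a (r/4)" for b
    proof -
      have ab: "cmod (b - a) < r/4" using that by (simp add: dist_norm norm_minus_commute)
      have dist': "r/2 \<le> cmod (z - b)" if "z \<in> K" for z
        using dist[OF that] norm_triangle_ineq[of "z - b" "b - a"] ab r(1) by simp
      show ?thesis unfolding R_def
      proof
        assume "(\<lambda>z. inverse (z - a)) \<in> poly_closure K"
        then show "(\<lambda>z. inverse (z - b)) \<in> poly_closure K"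
          by (rule poly_closure_inverse_move[OF bK _ r(1) dist]) (use ab r in auto)
      next
        assume "(\<lambda>z. inverse (z - b)) \<in> poly_closure K"
        then show "(\<lambda>z. inverse (z - a)) \<in> poly_closure K"
          by (rule poly_closure_inverse_move[OF bK _ _ dist']) (use ab r in \<open>auto simp: norm_minus_commute\<close>)
      qed
    qed
    moreover have "ball a (r/4) \<subseteq> - K" using r by (auto simp: subset_iff)
    ultimately show "\<exists>T. openin (top_of_set (- K)) T \<and> a \<in> T \<and> (\<forall>x\<in>T. R a x)"
      using r(1) by (intro exI[of _ "ball a (r/4)"]) (auto intro: open_subset)
  qed (simp_all add: R_def)
  with bP show ?thesis by (simp add: R_def)
qed

subsection \<open>A bounded substitute for the Cauchy kernel\<close>

text \<open>The hypotheses put \<open>s\<close> and \<open>t\<close> into the sector of arguments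
  below pi/4 in modulus, so the arguments of the product stay below pi/2. This keeps the branch
  fixed when local square roots are multiplied.\<close>

lemma Re_mult_pos:
  assumes "Re s > 0" "Re t > 0" "Re (s\<^sup>2) > 0" "Re (t\<^sup>2) > 0"
  shows "Re (s * t) > 0"
proof -
  have *: "\<bar>Im u\<bar> < Re u" if "Re u > 0" "Re (u\<^sup>2) > 0" for u
    using that abs_le_square_iff[of "Re u" "Im u"] by (auto simp: Re_power2)
  have "\<bar>Im s * Im t\<bar> < Re s * Re t"
    unfolding abs_mult using *[of s] *[of t] assms by (intro mult_strict_mono) auto
  then show ?thesis by simp
qed

text \<open>The quotient is 1 + (q - p)/(z - q), and the second summand has modulus below 1 because
  |q - p| is at most 2d while |z - q| is at least 3d.\<close>

lemma Re_divide_pos_far: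
  assumes "p \<in> ball c d" "q \<in> ball c d" "4 * d \<le> cmod (z - c)"
  shows "Re ((z - p) / (z - q)) > 0"
proof -
  have d: "cmod (p - c) < d" "cmod (q - c) < d" using assms by (auto simp: dist_norm norm_minus_commute)
  have "3 * d \<le> cmod (z - q)"
    using norm_triangle_ineq[of "z - q" "q - c"] d assms(3) by simp
  moreover have "cmod (q - p) \<le> 2 * d"
    using norm_triangle_ineq4[of "q - c" "p - c"] d by simp
  moreover have "d > 0" using d(1) norm_ge_zero[of "p - c"] by linarith
  ultimately have *: "z \<noteq> q" "cmod ((q - p) / (z - q)) < 1"
    by (auto simp: norm_divide divide_less_eq)
  then have "(z - p) / (z - q) = 1 + (q - p) / (z - q)"
    by (simp add: divide_simps)
  moreover have "- cmod ((q - p) / (z - q)) \<le> Re ((q - p) / (z - q))"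
    using abs_Re_le_cmod[of "(q - p) / (z - q)"] by linarith
  ultimately show ?thesis using * by simp
qed

text \<open>The quotient equals 1 + (b - a)/(z - b) with a perturbation of modulus at most 1/2 on
  \<open>K\<close>, so the principal root is given by a power series.\<close>

lemma poly_closure_sqrt_near:
  assumes K: "compact K" "connected (- K)" and r: "ball a r \<subseteq> - K" and b: "b \<in> ball a (r/4)"
  shows "\<exists>s\<in>poly_closure K. \<forall>z\<in>K. (s z)\<^sup>2 = (z - a) / (z - b) \<and> Re (s z) > 0"
proof -
  have bK: "bounded K" using K compact_imp_bounded by blast
  have ba: "cmod (b - a) < r/4" using b by (simp add: dist_norm norm_minus_commute)
  then have "r > 0" using norm_ge_zero[of "b - a"] by linarith
  have far: "3 * r / 4 \<le> cmod (z - b)" if "z \<in> K" for z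
  proof -
    have "r \<le> cmod (z - a)" using r that by (force simp: dist_norm norm_minus_commute)
    then show ?thesis using norm_triangle_ineq[of "z - b" "b - a"] ba by simp
  qed
  have "b \<notin> K" using far[of b] \<open>r > 0\<close> by auto
  define x where "x z = (b - a) * inverse (z - b)" for z
  have x: "x \<in> poly_closure K"
    unfolding x_def by (intro poly_closure_mult bK poly_closure_const poly_closure_inverse K \<open>b \<notin> K\<close>)
  have xb: "cmod (x z) \<le> 1/2" if "z \<in> K" for z
  proof -
    have "cmod (x z) = cmod (b - a) / cmod (z - b)"
      by (simp add: x_def norm_mult norm_inverse divide_inverse)
    also have "\<dots> \<le> 1/2"
    proof -
      have "cmod (b - a) \<le> 1/2 * cmod (z - b)" "cmod (z - b) > 0"
        using ba far[OF that] \<open>r > 0\<close> by linarith+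
      then show ?thesis by (subst pos_divide_le_eq)
    qed
    finally show ?thesis .
  qed
  have "(\<lambda>z. csqrt (1 + x z)) \<in> poly_closure K"
  proof (rule poly_closure_compose_holomorphic[OF bK x _ _ xb])
    show "(\<lambda>w. csqrt (1 + w)) holomorphic_on ball 0 1"
    proof (intro holomorphic_intros)
      fix w :: complex assume "w \<in> ball 0 1"
      then have "Re (1 + w) > 0" using abs_Re_le_cmod[of w] by simp
      then show "1 + w \<notin> \<real>\<^sub>\<le>\<^sub>0" by (auto simp: complex_nonpos_Reals_iff)
    qed
  qed auto
  moreover have "(csqrt (1 + x z))\<^sup>2 = (z - a) / (z - b) \<and> Re (csqrt (1 + x z)) > 0" if "z \<in> K" for z
  proof
    have "z \<noteq> b" using that \<open>b \<notin> K\<close> by auto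
    then show "(csqrt (1 + x z))\<^sup>2 = (z - a) / (z - b)"
      by (simp add: x_def field_simps)
    have "Re (1 + x z) > 0" using abs_Re_le_cmod[of "x z"] xb[OF that] by simp
    then have "Re ((csqrt (1 + x z))\<^sup>2) > 0" by simp
    then have "Re (csqrt (1 + x z)) \<noteq> 0"
      unfolding Re_power2 using zero_le_power2[of "Im (csqrt (1 + x z))"] by auto
    then show "Re (csqrt (1 + x z)) > 0" using csqrt_principal[of "1 + x z"] by auto
  qed
  ultimately show ?thesis by (intro bexI[of _ "\<lambda>z. csqrt (1 + x z)"] ballI)
qed

text \<open>Local roots for nearby points are multiplied along a chain from \<open>p\<close> to
  \<open>q\<close> inside \<open>S\<close>. The sign condition away from the disc selects one of the
  two roots there, so that the result behaves like 1 at infinity.\<close>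

lemma poly_closure_sqrt:
  assumes K: "compact K" "connected (- K)"
    and S: "open S" "connected S" "S \<subseteq> - K" "S \<subseteq> ball c d" and "p \<in> S" "q \<in> S"
  shows "\<exists>s\<in>poly_closure K. \<forall>z\<in>K. (s z)\<^sup>2 = (z - p) / (z - q) \<and> (4 * d \<le> cmod (z - c) \<longrightarrow> Re (s z) > 0)"
proof -
  have bK: "bounded K" using K compact_imp_bounded by blast
  have far: "Re ((z - p) / (z - q)) > 0" if "4 * d \<le> cmod (z - c)" "p \<in> S" "q \<in> S" for z p q
    using Re_divide_pos_far[OF _ _ that(1)] S(4) that(2,3) by blast
  have ne: "z \<noteq> p" if "z \<in> K" "p \<in> S" for z p using S(3) that by auto
  define R where "R p q \<longleftrightarrow> (\<exists>s\<in>poly_closure K.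
    \<forall>z\<in>K. (s z)\<^sup>2 = (z - p) / (z - q) \<and> (4 * d \<le> cmod (z - c) \<longrightarrow> Re (s z) > 0))" for p q
  have "R p q"
  proof (rule connected_equivalence_relation[OF S(2), where R = R])
    show "p \<in> S" "q \<in> S" by fact+
  next
    fix p q assume "R p q" and pq: "p \<in> S" "q \<in> S"
    then obtain s where s: "s \<in> poly_closure K" "\<forall>z\<in>K. (s z)\<^sup>2 = (z - p) / (z - q) \<and> (4 * d \<le> cmod (z - c) \<longrightarrow> Re (s z) > 0)"
      unfolding R_def by blast
    \<comment> \<open>Since the square of \<open>s\<close> is (z - p)/(z - q), its inverse is
      \<open>s\<close> times (z - q)/(z - p), which visibly lies in the algebra.\<close>
    have "(\<lambda>z. s z * ((z + (- q)) * inverse (z - p))) \<in> poly_closure K"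
      by (intro poly_closure_mult[OF bK] poly_closure_add poly_closure_const poly_closure_ident
            poly_closure_inverse K s(1)) (use pq S(3) in auto)
    then have s': "(\<lambda>z. inverse (s z)) \<in> poly_closure K"
    proof (rule poly_closure_cong)
      fix z assume z: "z \<in> K"
      have sz: "s z * s z = (z - p) / (z - q)" using s(2) z by (simp add: power2_eq_square)
      with ne[OF z pq(1)] ne[OF z pq(2)] have "s z \<noteq> 0" by auto
      have "s z * (s z * ((z + - q) * inverse (z - p))) = 1"
        using ne[OF z pq(1)] ne[OF z pq(2)] by (simp add: mult.assoc[symmetric] sz)
      then show "inverse (s z) = s z * ((z + - q) * inverse (z - p))"
        using \<open>s z \<noteq> 0\<close> by (simp add: inverse_unique)
    qed
    moreover have "(inverse (s z))\<^sup>2 = (z - q) / (z - p) \<and> (4 * d \<le> cmod (z - c) \<longrightarrow> Re (inverse (s z)) > 0)"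
      if "z \<in> K" for z
    proof -
      have "(inverse (s z))\<^sup>2 = (z - q) / (z - p)" using s(2) that by (simp add: power_inverse)
      moreover have "Re (inverse (s z)) > 0" if "Re (s z) > 0"
        using that by (simp add: complex_inverse) (auto intro!: divide_pos_pos sum_power2_gt_zero_iff[THEN iffD2] simp: add_pos_nonneg)
      ultimately show ?thesis using s(2) that by blast
    qed
    ultimately show "R q p" unfolding R_def by (intro bexI[of _ "\<lambda>z. inverse (s z)"]) auto
  next
    fix p q r assume "R p q" "R q r" and pqr: "p \<in> S" "q \<in> S" "r \<in> S"
    then obtain s t where
      s: "s \<in> poly_closure K" "\<forall>z\<in>K. (s z)\<^sup>2 = (z - p) / (z - q) \<and> (4 * d \<le> cmod (z - c) \<longrightarrow> Re (s z) > 0)" and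
      t: "t \<in> poly_closure K" "\<forall>z\<in>K. (t z)\<^sup>2 = (z - q) / (z - r) \<and> (4 * d \<le> cmod (z - c) \<longrightarrow> Re (t z) > 0)"
      unfolding R_def by metis
    have "(s z * t z)\<^sup>2 = (z - p) / (z - r) \<and> (4 * d \<le> cmod (z - c) \<longrightarrow> Re (s z * t z) > 0)"
      if z: "z \<in> K" for z
    proof (intro conjI impI)
      show "(s z * t z)\<^sup>2 = (z - p) / (z - r)"
        using s(2) t(2) z ne[OF z pqr(2)] by (simp add: power_mult_distrib)
      assume *: "4 * d \<le> cmod (z - c)"
      have "Re (s z) > 0" "Re (t z) > 0" using s(2) t(2) z * by blast+
      moreover have "Re ((s z)\<^sup>2) > 0" "Re ((t z)\<^sup>2) > 0"
        using s(2) t(2) z far[OF * pqr(1,2)] far[OF * pqr(2,3)] by metis+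
      ultimately show "Re (s z * t z) > 0" by (rule Re_mult_pos)
    qed
    then show "R p r" unfolding R_def
      by (intro bexI[of _ "\<lambda>z. s z * t z"] poly_closure_mult[OF bK] s(1) t(1)) auto
  next
    fix a assume "a \<in> S"
    then obtain r where r: "r > 0" "ball a r \<subseteq> S"
      using S(1) by (meson open_contains_ball)
    have "R a b" if "b \<in> ball a (r/4)" for b
      unfolding R_def using poly_closure_sqrt_near[OF K _ that] r S(3) by blast
    moreover have "ball a (r/4) \<subseteq> S" using r by (auto simp: subset_iff)
    ultimately show "\<exists>T. openin (top_of_set S) T \<and> a \<in> T \<and> (\<forall>x\<in>T. R a x)"
      using r(1) by (intro exI[of _ "ball a (r/4)"]) (auto intro: open_subset)
  qed
  then show ?thesis by (simp add: R_def)
qed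

text \<open>Take the component of \<open>p\<close> in the part of \<open>U\<close> inside the disc.
  If it stayed within half the radius, it would be clopen in \<open>U\<close>, hence equal to the
  unbounded set \<open>U\<close>.\<close>

lemma connected_open_reaches_sphere:
  fixes U :: "complex set"
  assumes U: "open U" "connected U" "\<not> bounded U" and p: "p \<in> U" "p \<in> ball c d"
  obtains S q where "open S" "connected S" "S \<subseteq> U" "S \<subseteq> ball c d" "p \<in> S" "q \<in> S" "d/2 \<le> cmod (q - c)"
proof -
  define S where "S = connected_component_set (U \<inter> ball c d) p"
  have "open S"
    unfolding S_def by (rule open_connected_component) (use U(1) in auto)
  moreover have "S \<subseteq> U \<inter> ball c d" "connected S"
    unfolding S_def by (rule connected_component_subset connected_connected_component)+
  moreover have "p \<in> S"
    unfolding S_def using p by (simp add: connected_component_refl)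
  ultimately have S: "open S" "connected S" "S \<subseteq> U \<inter> ball c d" "p \<in> S"
    by blast+
  have "\<exists>q\<in>S. d/2 \<le> cmod (q - c)"
  proof (rule ccontr)
    assume "\<not> ?thesis"
    then have small: "S \<subseteq> cball c (d/2)" by (force simp: dist_norm norm_minus_commute)
    have "d > 0" using p(2) by (metis ball_eq_empty empty_iff not_le)
    have "closedin (top_of_set U) S"
    proof -
      have "closedin (top_of_set (U \<inter> ball c d)) S"
        unfolding S_def by (rule closedin_connected_component)
      then obtain T where T: "closed T" "S = U \<inter> ball c d \<inter> T" by (auto simp: closedin_closed)
      have "S = U \<inter> (cball c (d/2) \<inter> T)" using T(2) small \<open>d > 0\<close> by (auto simp: subset_iff)
      then show ?thesis using T(1) by (metis closed_Int closed_cball closedin_closed_Int)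
    qed
    moreover have "openin (top_of_set U) S" using S by (intro open_subset) auto
    ultimately have "S = U" using U(2) S(4) unfolding connected_clopen by blast
    then show False using U(3) small bounded_subset bounded_cball by blast
  qed
  then show ?thesis using that S by blast
qed

text \<open>With \<open>s = sqrt ((z - p) / (z - q))\<close>, the function
  \<open>4 (z - q) (s - 1)\<^sup>2 / (p - q)\<^sup>2 = 4 / ((z - q) (1 + s)\<^sup>2)\<close> (an inverse Joukowski map of the slit joining
  \<open>p\<close> to \<open>q\<close>) behaves like \<open>1 / (z - c)\<close> away from the disc containing the slit and stays bounded near it.\<close>
lemma poly_closure_tame_inverse:
  assumes K: "compact K" "connected (- K)" "interior K = {}" and d: "d > 0"
  obtains g where "g \<in> poly_closure K"
    "\<And>z. z \<in> K \<Longrightarrow> cmod (z - c) < 4 * d \<Longrightarrow> cmod (g z) \<le> 1280 / d"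
    "\<And>z. z \<in> K \<Longrightarrow> 4 * d \<le> cmod (z - c) \<Longrightarrow> cmod (g z - 1 / (z - c)) \<le> 26 * d / (cmod (z - c))\<^sup>2"
proof -
  have bK: "bounded K" using K compact_imp_bounded by blast
  \<comment> \<open>Empty interior supplies \<open>p\<close> within \<open>d/4\<close> of
    \<open>c\<close>, whereas \<open>q\<close> will be at least \<open>d/2\<close> away; this bounds
    |p - q| below by \<open>d/4\<close>, which controls the factor 4/(p - q)^2 in
    \<open>g\<close>.\<close>
  have "\<not> ball c (d/4) \<subseteq> K" using K(3) d by (metis interior_maximal centre_in_ball divide_pos_pos empty_iff open_ball subset_eq zero_less_numeral)
  then obtain p where p: "p \<in> - K" "p \<in> ball c (d/4)" by blast
  have "\<not> bounded (- K)" using bK cobounded_imp_unbounded[of "- K"] by auto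
  moreover have "p \<in> ball c d" using p(2) d by auto
  moreover have "open (- K)" using K(1) compact_imp_closed by blast
  ultimately obtain S q where S: "open S" "connected S" "S \<subseteq> - K" "S \<subseteq> ball c d" "p \<in> S" "q \<in> S"
    and q: "d/2 \<le> cmod (q - c)"
    using connected_open_reaches_sphere[of "- K" p c d] K(2) p(1) by blast
  from poly_closure_sqrt[OF K(1,2) S] obtain s where s: "s \<in> poly_closure K"
    "\<And>z. z \<in> K \<Longrightarrow> (s z)\<^sup>2 = (z - p) / (z - q)"
    "\<And>z. z \<in> K \<Longrightarrow> 4 * d \<le> cmod (z - c) \<Longrightarrow> Re (s z) > 0" by blast
  have qd: "cmod (q - c) < d" and pd: "cmod (p - c) < d/4"
    using S(4,6) p(2) by (auto simp: dist_norm norm_minus_commute subset_iff)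
  have pq: "d/4 \<le> cmod (p - q)" "cmod (p - q) \<le> 2 * d"
    using norm_triangle_ineq4[of "p - c" "q - c"] norm_triangle_ineq[of "p - q" "c - p"] norm_triangle_ineq4[of "p-c" "p-q"] pd qd q d
    by (simp_all add: norm_minus_commute)
  then have "p \<noteq> q" using d by auto
  define g where "g z = 4 / (p - q)\<^sup>2 * ((z + (- q)) * (s z + (- 1))\<^sup>2)" for z
  have "g \<in> poly_closure K" unfolding g_def
    by (intro poly_closure_mult[OF bK] poly_closure_const poly_closure_add poly_closure_ident
          poly_closure_power[OF bK] s(1))
  moreover have "cmod (g z) \<le> 1280 / d" if z: "z \<in> K" "cmod (z - c) < 4 * d" for z
  proof -
    have zq: "z \<noteq> q" using z S by auto
    have "cmod (z - p) \<le> 5 * d" "cmod (z - q) \<le> 5 * d"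
      using norm_triangle_ineq4[of "z - c" "p - c"] norm_triangle_ineq4[of "z - c" "q - c"] z pd qd d by simp_all
    \<comment> \<open>This trades the size of \<open>s\<close> near its pole for |z - p|: |z - q| |s
      - 1|^2 is at most 2 |z - p| + 2 |z - q|, so at most 20d, and 4 * 16 * 20 = 1280.\<close>
    moreover have "cmod (z - p) = cmod (z - q) * (cmod (s z))\<^sup>2"
      using s(2)[OF z(1)] zq by (simp flip: norm_power norm_mult)
    moreover have "(cmod (s z - 1))\<^sup>2 \<le> 2 * (cmod (s z))\<^sup>2 + 2"
    proof -
      have "(cmod (s z - 1))\<^sup>2 \<le> (cmod (s z) + 1)\<^sup>2"
        using norm_triangle_ineq4[of "s z" 1] by (intro power_mono) auto
      also have "\<dots> \<le> 2 * (cmod (s z))\<^sup>2 + 2"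
        using zero_le_power2[of "cmod (s z) - 1"] by (simp add: power2_eq_square algebra_simps)
      finally show ?thesis .
    qed
    then have "cmod (z - q) * (cmod (s z - 1))\<^sup>2 \<le> cmod (z - q) * (2 * (cmod (s z))\<^sup>2 + 2)"
      by (intro mult_left_mono) auto
    ultimately have *: "cmod (z - q) * (cmod (s z - 1))\<^sup>2 \<le> 20 * d"
      by (simp add: algebra_simps)
    have "(d/4)\<^sup>2 \<le> (cmod (p - q))\<^sup>2" using pq(1) d by (intro power_mono) auto
    then have "4 / (cmod (p - q))\<^sup>2 \<le> 4 / (d/4)\<^sup>2"
      using d by (intro divide_left_mono mult_pos_pos) (auto simp: \<open>p \<noteq> q\<close>)
    then have "4 / (cmod (p - q))\<^sup>2 * (cmod (z - q) * (cmod (s z - 1))\<^sup>2) \<le> 4 / (d/4)\<^sup>2 * (20 * d)"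
      using * d by (intro mult_mono[of "4 / _"]) auto
    also have "\<dots> = 1280 / d" using d by (simp add: power2_eq_square field_simps)
    finally show ?thesis by (simp add: g_def norm_mult norm_divide norm_power)
  qed
  moreover have "cmod (g z - 1 / (z - c)) \<le> 26 * d / (cmod (z - c))\<^sup>2"
    if z: "z \<in> K" "4 * d \<le> cmod (z - c)" for z
  proof -
    have zq: "z - q \<noteq> 0" using z S by auto
    have zc: "z - c \<noteq> 0" using z(2) d by auto
    have half: "cmod (z - c) / 2 \<le> cmod (z - q)"
      using norm_triangle_ineq[of "z - q" "q - c"] z(2) qd d by simp
    have s1: "1 \<le> cmod (1 + s z)" using complex_Re_le_cmod[of "1 + s z"] s(3)[OF z] by simp
    then have s0: "1 + s z \<noteq> 0" by auto
    have ss: "(z - q) * (s z)\<^sup>2 = z - p" using s(2)[OF z(1)] zq by simp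
    \<comment> \<open>This factorization turns \<open>g\<close> into 4/((z - q)(1 + s)^2). As Re s >
      0, the factor 1 + s has modulus at least 1.\<close>
    then have pqs: "p - q = (z - q) * (1 - s z) * (1 + s z)"
      by (simp add: algebra_simps power2_eq_square)
    then have s10: "1 - s z \<noteq> 0" using \<open>p \<noteq> q\<close> by auto
    have "g z = 4 * ((z - q) * (s z - 1)\<^sup>2) / ((z - q) * (1 - s z) * (1 + s z))\<^sup>2"
      unfolding g_def pqs by simp
    also have "\<dots> = 4 / ((z - q) * (1 + s z)\<^sup>2)"
      using zq s0 s10 by (simp add: divide_simps) (simp add: algebra_simps power2_eq_square)
    finally have g: "g z = 4 / ((z - q) * (1 + s z)\<^sup>2)" .
    have "g z - 1 / (z - q) = (4 - (1 + s z)\<^sup>2) / ((z - q) * (1 + s z)\<^sup>2)"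
      unfolding g using zq s0 by (simp add: diff_divide_distrib)
    also have "\<dots> = (p - q) * (3 + s z) / ((z - q)\<^sup>2 * (1 + s z) ^ 3)"
      unfolding pqs using zq s0
      by (simp add: divide_simps) (simp add: algebra_simps power2_eq_square power3_eq_cube)
    finally have "cmod (g z - 1 / (z - q)) = cmod (p - q) / (cmod (z - q))\<^sup>2 * (cmod (3 + s z) / cmod (1 + s z) ^ 3)"
      by (simp add: norm_mult norm_divide norm_power)
    \<comment> \<open>The constant is 2 * 4 * 3 = 24; replacing \<open>q\<close> by the centre
      \<open>c\<close> afterwards costs another 2, whence 26.\<close>
    also have "\<dots> \<le> (2 * d) / (cmod (z - c) / 2)\<^sup>2 * 3"
    proof (intro mult_mono frac_le power_mono pq half)
      have "cmod (3 + s z) \<le> 2 + cmod (1 + s z)" using norm_triangle_ineq[of 2 "1 + s z"] by simp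
      also have "\<dots> \<le> 3 * cmod (1 + s z)" using s1 by simp
      also have "\<dots> \<le> 3 * cmod (1 + s z) ^ 3" using s1 self_le_power[of "cmod (1 + s z)" 3] by simp
      finally show "cmod (3 + s z) / cmod (1 + s z) ^ 3 \<le> 3" using s0 by (simp add: divide_le_eq)
    qed (use d zc in auto)
    finally have 1: "cmod (g z - 1 / (z - q)) \<le> 24 * d / (cmod (z - c))\<^sup>2"
      by (simp add: power_divide)
    have "1 / (z - q) - 1 / (z - c) = (q - c) / ((z - q) * (z - c))"
      using zq zc by (simp add: field_simps)
    then have "cmod (1 / (z - q) - 1 / (z - c)) = cmod (q - c) / (cmod (z - q) * cmod (z - c))"
      by (simp add: norm_mult norm_divide)
    also have "\<dots> \<le> d / (cmod (z - c) / 2 * cmod (z - c))"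
      using qd half zc d by (intro frac_le mult_right_mono) auto
    finally have 2: "cmod (1 / (z - q) - 1 / (z - c)) \<le> 2 * d / (cmod (z - c))\<^sup>2"
      by (simp add: power2_eq_square mult.commute)
    show ?thesis
      using norm_triangle_ineq[of "g z - 1 / (z - q)" "1 / (z - q) - 1 / (z - c)"] 1 2
      by (simp add: add_divide_distrib[symmetric])
  qed
  ultimately show ?thesis by (rule that)
qed

subsection \<open>Contour integrals over a grid of squares\<close>

abbreviation kern :: "complex \<Rightarrow> complex \<Rightarrow> complex" where
  "kern z \<zeta> \<equiv> cnj (\<zeta> - z) / (\<zeta> - z)"

lemma cmod_kern_le: "cmod (kern z \<zeta>) \<le> 1"
  by (simp add: norm_divide del: complex_cnj_diff)

text \<open>If \<open>z\<close> lies on the segment, the kernel is constant on it except at \<open>z\<close> itself.\<close>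
lemma kern_integrable_linepath: "kern z contour_integrable_on linepath a b"
proof (cases "z \<in> closed_segment a b \<and> a \<noteq> b")
  case True
  then obtain u where u: "z = linepath a b u" by (auto simp: closed_segment_image_interval linepath_def)
  have "((\<lambda>t. kern z (linepath a b t) * (b - a)) has_integral cnj (b - a)) {0..1}"
  proof (rule has_integral_spike_finite[where S = "{u}"])
    show "((\<lambda>_. cnj (b - a)) has_integral cnj (b - a)) {0..1::real}"
      using has_integral_const_real[of "cnj (b - a)" 0 1] by simp
    fix t assume "t \<in> {0..1} - {u}"
    then have "t \<noteq> u" by auto
    have "linepath a b t - z = of_real (t - u) * (b - a)"
      by (simp add: u linepath_def scaleR_conv_of_real algebra_simps)
    then show "kern z (linepath a b t) * (b - a) = cnj (b - a)"
      using True \<open>t \<noteq> u\<close> by (simp del: complex_cnj_diff of_real_diff)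
  qed auto
  then show ?thesis
    unfolding contour_integrable_on_def has_contour_integral_linepath by blast
next
  case False
  show ?thesis
  proof (cases "a = b")
    case True
    then show ?thesis unfolding contour_integrable_on_def by blast
  next
    case ne: False
    show ?thesis
      by (intro contour_integrable_continuous_linepath continuous_intros) (use False ne in auto)
  qed
qed

lemma linepath_contour_integral_swap:
  "contour_integral (linepath b a) f = - contour_integral (linepath a b) f"
  using contour_integral_reversepath[of "linepath a b" f] by simp

lemma linepath_contour_integral_sum:
  assumes "\<And>a b. f contour_integrable_on linepath a b"
  shows "(\<Sum>i<n. contour_integral (linepath (a + of_nat i * w) (a + of_nat (Suc i) * w)) f)
           = contour_integral (linepath a (a + of_nat n * w)) f"
proof (induction n)
  case 0
  show ?case
    by (simp only: lessThan_0 sum.empty of_nat_0 mult_zero_left add_0_right)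
       (rule contour_integral_unique[OF has_contour_integral_trivial, symmetric])
next
  case (Suc n)
  have "contour_integral (linepath a (a + of_nat (Suc n) * w)) f =
      contour_integral (linepath a (a + of_nat n * w)) f
      + contour_integral (linepath (a + of_nat n * w) (a + of_nat (Suc n) * w)) f"
  proof (rule contour_integral_unique, rule has_contour_integral_split)
    show "a + of_nat n * w - a = (real n / real (Suc n)) *\<^sub>R (a + of_nat (Suc n) * w - a)"
      by (simp add: scaleR_conv_of_real field_simps del: of_nat_Suc)
  qed (use assms in \<open>auto intro: has_contour_integral_integral\<close>)
  with Suc show ?case by simp
qed

lemma contour_integral_rectpath:
  assumes "f contour_integrable_on rectpath (Complex x y) (Complex x' y')"
  shows "contour_integral (rectpath (Complex x y) (Complex x' y')) f =
    contour_integral (linepath (Complex x y) (Complex x' y)) f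
    + contour_integral (linepath (Complex x' y) (Complex x' y')) f
    - contour_integral (linepath (Complex x y') (Complex x' y')) f
    - contour_integral (linepath (Complex x y) (Complex x y')) f"
  using assms linepath_contour_integral_swap[of "Complex x' y'" "Complex x y'" f]
    linepath_contour_integral_swap[of "Complex x y'" "Complex x y" f]
  by (simp add: rectpath_def Let_def)

lemma contour_integrable_rectpath:
  assumes "\<And>a b. f contour_integrable_on linepath a b"
  shows "f contour_integrable_on rectpath a b"
  using assms by (simp add: rectpath_def Let_def)

text \<open>Every inner edge is run through twice in opposite directions. Formally, the horizontal
  edges \<open>H\<close> telescope in \<open>j\<close> and the vertical edges \<open>V\<close> in
  \<open>i\<close>.\<close>

lemma contour_integral_grid:
  fixes x y d :: real
  assumes f: "\<And>a b. f contour_integrable_on linepath a b"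
  shows "(\<Sum>i<m. \<Sum>j<n. contour_integral (rectpath (Complex (x + real i * d) (y + real j * d))
              (Complex (x + real (Suc i) * d) (y + real (Suc j) * d))) f)
         = contour_integral (rectpath (Complex x y) (Complex (x + real m * d) (y + real n * d))) f"
proof -
  define X where "X i = x + real i * d" for i
  define Y where "Y j = y + real j * d" for j
  define H where "H i j = contour_integral (linepath (Complex (X i) (Y j)) (Complex (X (Suc i)) (Y j))) f" for i j
  define V where "V i j = contour_integral (linepath (Complex (X i) (Y j)) (Complex (X i) (Y (Suc j)))) f" for i j
  have cell: "contour_integral (rectpath (Complex (X i) (Y j)) (Complex (X (Suc i)) (Y (Suc j)))) f
      = H i j - H i (Suc j) + (V (Suc i) j - V i j)" for i j
    by (simp add: contour_integral_rectpath[OF contour_integrable_rectpath[OF f]] H_def V_def)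
  have Hsum: "(\<Sum>i<m. H i j) = contour_integral (linepath (Complex (X 0) (Y j)) (Complex (X m) (Y j))) f" for j
    using linepath_contour_integral_sum[OF f, of "Complex x (Y j)" "of_real d" m]
    by (simp add: H_def X_def Complex_eq algebra_simps)
  have Vsum: "(\<Sum>j<n. V i j) = contour_integral (linepath (Complex (X i) (Y 0)) (Complex (X i) (Y n))) f" for i
    using linepath_contour_integral_sum[OF f, of "Complex (X i) y" "\<i> * of_real d" n]
    by (simp add: V_def Y_def Complex_eq algebra_simps)
  have "(\<Sum>i<m. \<Sum>j<n. H i j - H i (Suc j) + (V (Suc i) j - V i j))
      = (\<Sum>i<m. \<Sum>j<n. H i j - H i (Suc j)) + (\<Sum>i<m. \<Sum>j<n. V (Suc i) j - V i j)"
    by (simp only: sum.distrib)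
  also have "(\<Sum>i<m. \<Sum>j<n. V (Suc i) j - V i j) = (\<Sum>i<m. (\<Sum>j<n. V (Suc i) j) - (\<Sum>j<n. V i j))"
    by (simp only: sum_subtractf)
  also have "\<dots> = (\<Sum>j<n. V m j) - (\<Sum>j<n. V 0 j)"
    by (rule sum_lessThan_telescope)
  also have "(\<Sum>i<m. \<Sum>j<n. H i j - H i (Suc j)) = (\<Sum>i<m. H i 0) - (\<Sum>i<m. H i n)"
    unfolding sum_lessThan_telescope' by (rule sum_subtractf)
  finally have "(\<Sum>i<m. \<Sum>j<n. H i j - H i (Suc j) + (V (Suc i) j - V i j)) =
      contour_integral (rectpath (Complex (X 0) (Y 0)) (Complex (X m) (Y n))) f"
    by (simp add: contour_integral_rectpath[OF contour_integrable_rectpath[OF f]] Hsum Vsum)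
  then show ?thesis unfolding cell[symmetric] by (simp add: X_def Y_def)
qed

section \<open>Integrals over a single square\<close>

lemma contour_integral_rectpath_bound:
  fixes d :: real
  assumes f: "f contour_integrable_on rectpath (Complex x y) (Complex (x + d) (y + d))"
    and "d \<ge> 0" "B \<ge> 0"
    and B: "\<And>\<zeta>. \<zeta> \<in> cbox (Complex x y) (Complex (x + d) (y + d)) \<Longrightarrow> cmod (f \<zeta>) \<le> B"
  shows "cmod (contour_integral (rectpath (Complex x y) (Complex (x + d) (y + d))) f) \<le> 4 * (B * d)"
proof -
  have seg: "cmod (contour_integral (linepath a b) f) \<le> B * d"
    if "a \<in> cbox (Complex x y) (Complex (x + d) (y + d))" "b \<in> cbox (Complex x y) (Complex (x + d) (y + d))"
      "cmod (b - a) = d" for a b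
  proof (cases "f contour_integrable_on linepath a b")
    case True
    then show ?thesis
      using contour_integral_bound_linepath[OF True \<open>B \<ge> 0\<close>] B that
        closed_segment_subset[OF that(1,2) convex_box(1)] by auto
  next
    \<comment> \<open>A non-integrable function has \<open>contour_integral\<close> 0 by convention,
      so the bound holds on every edge.\<close>
    case False
    then show ?thesis using \<open>d \<ge> 0\<close> \<open>B \<ge> 0\<close> by (simp add: not_integrable_contour_integral)
  qed
  have e: "cmod (Complex u v - Complex u' v') = \<bar>u - u'\<bar>" if "v = v'" for u v u' v'
    using that by (simp add: cmod_def)
  have e': "cmod (Complex u v - Complex u' v') = \<bar>v - v'\<bar>" if "u = u'" for u v u' v'
    using that by (simp add: cmod_def)
  have 1: "cmod (contour_integral (linepath (Complex x y) (Complex (x + d) y)) f) \<le> B * d"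
    by (rule seg) (use \<open>d \<ge> 0\<close> in \<open>auto simp: in_cbox_complex_iff e\<close>)
  have 2: "cmod (contour_integral (linepath (Complex (x + d) y) (Complex (x + d) (y + d))) f) \<le> B * d"
    by (rule seg) (use \<open>d \<ge> 0\<close> in \<open>auto simp: in_cbox_complex_iff e'\<close>)
  have 3: "cmod (contour_integral (linepath (Complex x (y + d)) (Complex (x + d) (y + d))) f) \<le> B * d"
    by (rule seg) (use \<open>d \<ge> 0\<close> in \<open>auto simp: in_cbox_complex_iff e\<close>)
  have 4: "cmod (contour_integral (linepath (Complex x y) (Complex x (y + d))) f) \<le> B * d"
    by (rule seg) (use \<open>d \<ge> 0\<close> in \<open>auto simp: in_cbox_complex_iff e'\<close>)
  have tri: "cmod (a + b - c - e) \<le> cmod a + cmod b + cmod c + cmod e" for a b c e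
    by (smt (verit) norm_triangle_ineq norm_triangle_ineq4)
  show ?thesis
    unfolding contour_integral_rectpath[OF f] by (rule order_trans[OF tri]) (use 1 2 3 4 in linarith)
qed

text \<open>The integrand is affine in the parameter of the segment, so the trapezoidal rule is
  exact; \<open>F\<close> is an antiderivative.\<close>

lemma has_contour_integral_cnj_linepath:
  "((\<lambda>\<zeta>. cnj (\<zeta> - c)) has_contour_integral (b - a) * (cnj (a - c) + cnj (b - c)) / 2) (linepath a b)"
proof -
  define F where "F = (\<lambda>t::real. (of_real t * cnj (a - c) + of_real t ^ 2 / 2 * cnj (b - a)) * (b - a))"
  have "((\<lambda>t. cnj (linepath a b t - c) * (b - a)) has_integral (F 1 - F 0)) {0..1}"
  proof (rule fundamental_theorem_of_calculus)
    fix t :: real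
    have "((\<lambda>w. (w * cnj (a - c) + w ^ 2 / 2 * cnj (b - a)) * (b - a)) has_field_derivative
        (cnj (a - c) + of_real t * cnj (b - a)) * (b - a)) (at (of_real t))"
      by (auto intro!: derivative_eq_intros)
    from has_vector_derivative_real_field[OF this]
    show "(F has_vector_derivative cnj (linepath a b t - c) * (b - a)) (at t within {0..1})"
      by (simp add: F_def linepath_def scaleR_conv_of_real algebra_simps o_def)
  qed auto
  moreover have "F 1 - F 0 = (b - a) * (cnj (a - c) + cnj (b - c)) / 2"
    by (simp add: F_def field_simps)
  ultimately show "((\<lambda>\<zeta>. cnj (\<zeta> - c)) has_contour_integral
      (b - a) * (cnj (a - c) + cnj (b - c)) / 2) (linepath a b)"
    by (simp add: has_contour_integral_linepath)
qed

text \<open>By Green's formula this is 2i times the enclosed area; here it is obtained by adding the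
  values on the four edges.\<close>

lemma contour_integral_cnj_square:
  fixes x y d :: real
  defines "c \<equiv> Complex (x + d/2) (y + d/2)"
  shows "contour_integral (rectpath (Complex x y) (Complex (x + d) (y + d))) (\<lambda>\<zeta>. cnj (\<zeta> - c))
     = 2 * \<i> * of_real (d\<^sup>2)"
proof -
  have f: "(\<lambda>\<zeta>. cnj (\<zeta> - c)) contour_integrable_on linepath a b" for a b
    using has_contour_integral_cnj_linepath contour_integrable_on_def by blast
  show ?thesis
    unfolding contour_integral_rectpath[OF contour_integrable_rectpath[OF f]]
      contour_integral_unique[OF has_contour_integral_cnj_linepath]
    by (simp add: c_def complex_eq_iff power2_eq_square field_simps)
qed

lemma contour_integral_kern_bound:
  assumes "d \<ge> 0"
  shows "cmod (contour_integral (rectpath (Complex x y) (Complex (x + d) (y + d))) (kern z)) \<le> 4 * d"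
  using contour_integral_rectpath_bound[OF contour_integrable_rectpath[OF kern_integrable_linepath] assms,
      of 1 x y z] cmod_kern_le by simp

text \<open>Expand the kernel to first order around the centre. The term with 1/(\<zeta> - z)
  integrates to 0 by Cauchy's theorem, the term with \<open>cnj (\<zeta> - c)\<close> yields the
  area, and the remainder is quadratically small.\<close>

lemma contour_integral_kern_far:
  fixes x y d :: real
  defines "c \<equiv> Complex (x + d/2) (y + d/2)"
  assumes d: "d > 0" and z: "4 * d \<le> cmod (z - c)"
  shows "cmod (contour_integral (rectpath (Complex x y) (Complex (x + d) (y + d))) (kern z)
                + 2 * \<i> * of_real (d\<^sup>2) / (z - c)) \<le> 8 * d ^ 3 / (cmod (z - c))\<^sup>2"
proof -
  let ?R = "rectpath (Complex x y) (Complex (x + d) (y + d))"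
  define D where "D = cmod (z - c)"
  have D: "D > 0" "4 * d \<le> D" using d z by (auto simp: D_def)
  have near: "cmod (\<zeta> - c) \<le> d" if "\<zeta> \<in> cbox (Complex x y) (Complex (x + d) (y + d))" for \<zeta>
  proof -
    have "\<bar>Re (\<zeta> - c)\<bar> \<le> d/2" "\<bar>Im (\<zeta> - c)\<bar> \<le> d/2"
      using that unfolding c_def in_cbox_complex_iff minus_complex.sel complex.sel
        atLeastAtMost_iff by linarith+
    then show ?thesis using cmod_le[of "\<zeta> - c"] by linarith
  qed
  have away: "D / 2 \<le> cmod (\<zeta> - z)" if "cmod (\<zeta> - c) < 2 * d" for \<zeta>
    using norm_triangle_ineq4[of "\<zeta> - c" "\<zeta> - z"] that D(2) unfolding D_def by simp
  \<comment> \<open>\<open>h\<close> is the remainder of the expansion; \<open>heq\<close> exhibits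
    the two factors of size at most \<open>d\<close> in its numerator.\<close>
  define h where "h \<zeta> = kern z \<zeta> - cnj (c - z) * (1 / (\<zeta> - z)) - cnj (\<zeta> - c) * (1 / (c - z))" for \<zeta>
  have zc: "z \<noteq> c" using D by (auto simp: D_def)
  have heq: "h \<zeta> = cnj (\<zeta> - c) * (c - \<zeta>) / ((\<zeta> - z) * (c - z))" if "\<zeta> \<noteq> z" for \<zeta>
  proof -
    have "a / u - b * (1 / u) - (a - b) * (1 / v) = (a - b) * (v - u) / (u * v)"
      if "u \<noteq> 0" "v \<noteq> 0" for a b u v :: complex
      using that by (simp add: field_simps)
    from this[of "\<zeta> - z" "c - z" "cnj (\<zeta> - z)" "cnj (c - z)"] show ?thesis
      using that zc by (simp add: h_def)
  qed
  have path_image: "path_image ?R \<subseteq> cbox (Complex x y) (Complex (x + d) (y + d))"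
    using d by (intro path_image_rectpath_subset_cbox) auto
  have hol: "(\<lambda>\<zeta>. 1 / (\<zeta> - z)) holomorphic_on ball c (2 * d)"
    by (intro holomorphic_intros) (use z d in \<open>auto simp: dist_norm norm_minus_commute\<close>)
  have "((\<lambda>\<zeta>. 1 / (\<zeta> - z)) has_contour_integral 0) ?R"
  proof (rule Cauchy_theorem_disc_simple[OF hol])
    show "path_image ?R \<subseteq> ball c (2 * d)"
      using path_image near d by (force simp: dist_norm norm_minus_commute subset_iff)
  qed auto
  then have i1: "((\<lambda>\<zeta>. cnj (c - z) * (1 / (\<zeta> - z))) has_contour_integral 0) ?R"
    using has_contour_integral_lmul by fastforce
  have int_cnj: "(\<lambda>\<zeta>. cnj (\<zeta> - c)) contour_integrable_on linepath a b" for a b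
    using has_contour_integral_cnj_linepath contour_integrable_on_def by blast
  then have "(\<lambda>\<zeta>. cnj (\<zeta> - c)) contour_integrable_on ?R"
    by (rule contour_integrable_rectpath)
  then have "((\<lambda>\<zeta>. cnj (\<zeta> - c)) has_contour_integral (2 * \<i> * of_real (d\<^sup>2))) ?R"
    using contour_integral_cnj_square[of x y d] has_contour_integral_integral unfolding c_def by metis
  then have i2: "((\<lambda>\<zeta>. cnj (\<zeta> - c) * (1 / (c - z))) has_contour_integral (2 * \<i> * of_real (d\<^sup>2)) * (1 / (c - z))) ?R"
    by (rule has_contour_integral_rmul)
  have "kern z contour_integrable_on ?R"
    by (rule contour_integrable_rectpath[OF kern_integrable_linepath])
  then have "(kern z has_contour_integral (contour_integral ?R (kern z))) ?R"
    by (rule has_contour_integral_integral)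
  then have "(h has_contour_integral (contour_integral ?R (kern z) - 0 - (2 * \<i> * of_real (d\<^sup>2)) * (1 / (c - z)))) ?R"
    unfolding h_def by (intro has_contour_integral_diff i1 i2)
  then have hI: "h contour_integrable_on ?R" "contour_integral ?R h = contour_integral ?R (kern z) + 2 * \<i> * of_real (d\<^sup>2) / (z - c)"
    using zc by (auto simp: contour_integral_unique field_simps contour_integrable_on_def)
  have hB: "cmod (h \<zeta>) \<le> 2 * d\<^sup>2 / D\<^sup>2" if "\<zeta> \<in> cbox (Complex x y) (Complex (x + d) (y + d))" for \<zeta>
  proof -
    have n: "cmod (\<zeta> - c) \<le> d" "D / 2 \<le> cmod (\<zeta> - z)"
      using near[OF that] away[of \<zeta>] d by auto
    then have "\<zeta> \<noteq> z" using D by auto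
    then have "cmod (h \<zeta>) = cmod (\<zeta> - c) * cmod (\<zeta> - c) / (cmod (\<zeta> - z) * D)"
      unfolding heq[OF \<open>\<zeta> \<noteq> z\<close>] D_def norm_divide norm_mult complex_mod_cnj
      by (simp add: norm_minus_commute)
    also have "\<dots> \<le> d * d / (D / 2 * D)"
      using n D d by (intro frac_le mult_mono mult_right_mono) auto
    finally show ?thesis by (simp add: power2_eq_square mult_ac)
  qed
  have "cmod (contour_integral ?R h) \<le> 4 * (2 * d\<^sup>2 / D\<^sup>2 * d)"
    by (rule contour_integral_rectpath_bound[OF hI(1)]) (use d hB in auto)
  then show ?thesis
    by (simp add: hI(2) D_def power2_eq_square power3_eq_cube mult.assoc)
qed

subsection \<open>Approximation of complex conjugation\<close>

lemma sum_inverse_dist_nat_le: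
  assumes "m \<le> n"
  shows "(\<Sum>i<n. 1 / (1 + \<bar>real i - real m\<bar>)) \<le> 2 * harm (Suc n)"
proof -
  have A: "(\<Sum>i\<in>{m..<n}. 1 / (1 + \<bar>real i - real m\<bar>)) \<le> harm (Suc n)"
  proof -
    have "(\<Sum>i\<in>{m..<n}. 1 / (1 + \<bar>real i - real m\<bar>)) = (\<Sum>k\<in>{1..n-m}. inverse (real k))"
      by (rule sum.reindex_bij_witness[of _ "\<lambda>k. k + m - 1" "\<lambda>i. i - m + 1"])
         (auto simp: of_nat_diff divide_inverse add.commute)
    also have "\<dots> \<le> harm (Suc n)" unfolding harm_def by (intro sum_mono2) auto
    finally show ?thesis .
  qed
  have B: "(\<Sum>i<m. 1 / (1 + \<bar>real i - real m\<bar>)) \<le> harm (Suc n)"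
  proof -
    have "(\<Sum>i<m. 1 / (1 + \<bar>real i - real m\<bar>)) = (\<Sum>k\<in>{2..m+1}. inverse (real k))"
      by (rule sum.reindex_bij_witness[of _ "\<lambda>k. m + 1 - k" "\<lambda>i. m + 1 - i"])
         (auto simp: of_nat_diff divide_inverse add.commute)
    also have "\<dots> \<le> harm (Suc n)" unfolding harm_def using assms by (intro sum_mono2) auto
    finally show ?thesis .
  qed
  have "{..<n} = {..<m} \<union> {m..<n}" using assms by auto
  then have "(\<Sum>i<n. 1 / (1 + \<bar>real i - real m\<bar>)) =
      (\<Sum>i<m. 1 / (1 + \<bar>real i - real m\<bar>)) + (\<Sum>i\<in>{m..<n}. 1 / (1 + \<bar>real i - real m\<bar>))"
    by (metis (no_types, lifting) finite_atLeastLessThan finite_lessThan ivl_disj_int_one(2) sum.union_disjoint)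
  with A B show ?thesis by linarith
qed

text \<open>Replacing \<open>y\<close> by an integer \<open>m\<close> at distance at most 1 costs a
  factor 2 in each term. For negative \<open>y\<close>, \<open>nat\<close> rounds up to 0, and the
  lower bound -1 keeps that distance at most 1.\<close>

lemma sum_inverse_dist_le:
  fixes y :: real
  assumes "-1 \<le> y" "y \<le> real n"
  shows "(\<Sum>i<n. 1 / (1 + \<bar>y - real i\<bar>)) \<le> 4 * harm (Suc n)"
proof -
  define m where "m = nat \<lfloor>y\<rfloor>"
  have m: "\<bar>y - real m\<bar> \<le> 1" "m \<le> n" using assms unfolding m_def by linarith+
  have "1 / (1 + \<bar>y - real i\<bar>) \<le> 2 * (1 / (1 + \<bar>real i - real m\<bar>))" for i
  proof -
    have "1 + \<bar>real i - real m\<bar> \<le> 2 * (1 + \<bar>y - real i\<bar>)"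
      using m(1) by (smt (verit))
    then have "2 / (2 * (1 + \<bar>y - real i\<bar>)) \<le> 2 / (1 + \<bar>real i - real m\<bar>)"
      by (intro frac_le add_pos_nonneg) auto
    moreover have "2 / (2 * (1 + \<bar>y - real i\<bar>)) = 1 / (1 + \<bar>y - real i\<bar>)"
      by (subst mult_divide_mult_cancel_left[of 2 1, simplified mult_1_right, symmetric]) auto
    ultimately show ?thesis by simp
  qed
  then have "(\<Sum>i<n. 1 / (1 + \<bar>y - real i\<bar>)) \<le> 2 * (\<Sum>i<n. 1 / (1 + \<bar>real i - real m\<bar>))"
    unfolding sum_distrib_left by (rule sum_mono)
  with sum_inverse_dist_nat_le[OF m(2)] show ?thesis by linarith
qed

text \<open>The function is 2i d^2 times the tame inverse for the centre of the square. The error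
  decays quadratically in the distance and is stated as a product of two one-variable factors, so
  that summing over the grid gives a product of two logarithms.\<close>

lemma poly_closure_square_approx:
  fixes x y d :: real
  assumes K: "compact K" "connected (- K)" "interior K = {}" and d: "d > 0"
  obtains g where "g \<in> poly_closure K"
    "\<And>z. z \<in> K \<Longrightarrow>
       cmod (contour_integral (rectpath (Complex x y) (Complex (x + d) (y + d))) (kern z) + g z)
       \<le> 70000 * d * (1 / (1 + \<bar>(Re z - x) / d - 1/2\<bar>)) * (1 / (1 + \<bar>(Im z - y) / d - 1/2\<bar>))"
proof -
  have bK: "bounded K" using K compact_imp_bounded by blast
  define c where "c = Complex (x + d/2) (y + d/2)"
  obtain g where g: "g \<in> poly_closure K"
    "\<And>z. z \<in> K \<Longrightarrow> cmod (z - c) < 4 * d \<Longrightarrow> cmod (g z) \<le> 1280 / d"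
    "\<And>z. z \<in> K \<Longrightarrow> 4 * d \<le> cmod (z - c) \<Longrightarrow> cmod (g z - 1 / (z - c)) \<le> 26 * d / (cmod (z - c))\<^sup>2"
    using poly_closure_tame_inverse[OF K d] by blast
  define I where "I z = contour_integral (rectpath (Complex x y) (Complex (x + d) (y + d))) (kern z)" for z
  define w where "w = 2 * \<i> * of_real (d\<^sup>2)"
  have w: "cmod w = 2 * d\<^sup>2" using d by (simp add: w_def norm_mult norm_power)
  have main: "cmod (I z + w * g z) \<le> 70000 * d * (1 / (1 + \<bar>(Re z - x) / d - 1/2\<bar>)) * (1 / (1 + \<bar>(Im z - y) / d - 1/2\<bar>))"
    if z: "z \<in> K" for z
  proof -
    define t where "t = cmod (z - c) / d"
    have t: "t \<ge> 0" "cmod (z - c) = t * d" using d by (auto simp: t_def)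
    have "cmod (I z + w * g z) \<le> 70000 * d / (1 + t)\<^sup>2"
    proof (cases "t < 4")
      case True
      \<comment> \<open>Near the square both terms are merely bounded: 4 + 2 * 1280 = 2564, and 2564
        * 25 is below 70000.\<close>
      have "cmod (I z + w * g z) \<le> cmod (I z) + cmod w * cmod (g z)"
        by (metis norm_mult norm_triangle_ineq)
      also have "\<dots> \<le> 4 * d + 2 * d\<^sup>2 * (1280 / d)"
        unfolding w using g(2)[OF z] True t d contour_integral_kern_bound[of d x y z]
        by (intro add_mono mult_left_mono) (auto simp: I_def)
      also have "\<dots> = 2564 * d" using d by (simp add: power2_eq_square)
      finally have 1: "cmod (I z + w * g z) \<le> 2564 * d" .
      have "(1 + t)\<^sup>2 \<le> 5\<^sup>2" using True t by (intro power_mono) auto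
      then have "2564 * d * (1 + t)\<^sup>2 \<le> 2564 * d * 25" using d by (intro mult_left_mono) auto
      also have "\<dots> \<le> 70000 * d" using d by simp
      finally have "2564 * d \<le> 70000 * d / (1 + t)\<^sup>2" using t by (subst pos_le_divide_eq) auto
      with 1 show ?thesis by linarith
    next
      case False
      then have far: "4 * d \<le> cmod (z - c)" using t d by auto
      \<comment> \<open>Far away the first-order terms of \<open>I\<close> and \<open>w * g\<close>
        cancel; what is left is 8 + 2 * 26 = 60 in units of d/t^2.\<close>
      have "I z + w * g z = (I z + w / (z - c)) + w * (g z - 1 / (z - c))"
        by (simp add: algebra_simps)
      then have "cmod (I z + w * g z) \<le> cmod (I z + w / (z - c)) + cmod w * cmod (g z - 1 / (z - c))"
        by (metis norm_mult norm_triangle_ineq)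
      also have "\<dots> \<le> 8 * d ^ 3 / (cmod (z - c))\<^sup>2 + 2 * d\<^sup>2 * (26 * d / (cmod (z - c))\<^sup>2)"
        unfolding w using g(3)[OF z far] contour_integral_kern_far[OF d far[unfolded c_def]] d
        by (intro add_mono mult_left_mono) (auto simp: I_def w_def c_def)
      also have "\<dots> = 60 * d / t\<^sup>2"
        using d by (simp add: t(2) power2_eq_square power3_eq_cube)
      finally have 1: "cmod (I z + w * g z) \<le> 60 * d / t\<^sup>2" .
      have "(1 + t)\<^sup>2 \<le> (2 * t)\<^sup>2" using False by (intro power_mono) auto
      then have "60 * d * (1 + t)\<^sup>2 \<le> 60 * d * (2 * t)\<^sup>2" using d by (intro mult_left_mono) auto
      also have "\<dots> \<le> 70000 * d * t\<^sup>2" using d by (simp add: power_mult_distrib)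
      finally have "60 * d / t\<^sup>2 \<le> 70000 * d / (1 + t)\<^sup>2"
        using False by (simp add: divide_simps)
      with 1 show ?thesis by linarith
    qed
    also have "\<dots> = 70000 * d * (1 / (1 + t)) * (1 / (1 + t))"
      by (simp add: power2_eq_square)
    also have "\<dots> \<le> 70000 * d * (1 / (1 + \<bar>(Re z - x) / d - 1/2\<bar>)) * (1 / (1 + \<bar>(Im z - y) / d - 1/2\<bar>))"
    proof -
      have "(Re z - x) / d - 1/2 = Re (z - c) / d" "(Im z - y) / d - 1/2 = Im (z - c) / d"
        using d by (auto simp: c_def field_simps)
      then have "\<bar>(Re z - x) / d - 1/2\<bar> \<le> t" "\<bar>(Im z - y) / d - 1/2\<bar> \<le> t"
        unfolding t_def using d abs_Re_le_cmod[of "z - c"] abs_Im_le_cmod[of "z - c"]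
        by (simp_all add: divide_right_mono del: minus_complex.sel)
      then show ?thesis using d t(1) by (intro mult_mono mult_nonneg_nonneg frac_le) auto
    qed
    finally show ?thesis .
  qed
  show ?thesis
  proof (rule that)
    show "(\<lambda>z. w * g z) \<in> poly_closure K"
      by (rule poly_closure_mult[OF bK poly_closure_const g(1)])
  qed (use main in \<open>simp add: I_def\<close>)
qed

section \<open>The Cauchy integral over the large square\<close>

lemma holomorphic_on_linepath_Cauchy_integral:
  assumes "continuous_on (closed_segment a b) f"
  shows "(\<lambda>z. contour_integral (linepath a b) (\<lambda>\<zeta>. f \<zeta> / (\<zeta> - z))) holomorphic_on - closed_segment a b"
proof -
  have int: "(\<lambda>\<zeta>. f \<zeta> / (\<zeta> - w)) contour_integrable_on linepath a b" if "w \<notin> closed_segment a b" for w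
    by (intro contour_integrable_continuous_linepath continuous_intros assms) (use that in auto)
  show ?thesis
    unfolding holomorphic_on_def
  proof
    fix z assume z: "z \<in> - closed_segment a b"
    have "((\<lambda>z. contour_integral (linepath a b) (\<lambda>\<zeta>. f \<zeta> / (\<zeta> - z))) has_field_derivative
        (of_nat 1 * contour_integral (linepath a b) (\<lambda>\<zeta>. f \<zeta> / (\<zeta> - z) ^ Suc 1))) (at z)"
    proof (rule Cauchy_next_derivative(2)[where S = UNIV and B = "norm (b - a)"])
      fix w assume "w \<in> UNIV - path_image (linepath a b)"
      then show "((\<lambda>\<zeta>. f \<zeta> / (\<zeta> - w) ^ 1) has_contour_integral
          contour_integral (linepath a b) (\<lambda>\<zeta>. f \<zeta> / (\<zeta> - w))) (linepath a b)"
        using int[of w] by (simp add: has_contour_integral_integral)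
    qed (use assms z in auto)
    then show "(\<lambda>z. contour_integral (linepath a b) (\<lambda>\<zeta>. f \<zeta> / (\<zeta> - z))) field_differentiable at z within - closed_segment a b"
      using field_differentiable_at_within field_differentiable_def by blast
  qed
qed

text \<open>Split \<open>cnj \<zeta>\<close> as \<open>cnj (\<zeta> - z) + cnj z\<close>; the
  constant part is multiplied by 2 pi i because the square winds once around \<open>z\<close>. This
  is how \<open>cnj z\<close> enters the approximation.\<close>

lemma contour_integral_kern_large_square:
  assumes R: "R > 0" and z: "cmod z < R"
  defines "Q \<equiv> rectpath (Complex (-R) (-R)) (Complex R R)"
  shows "((\<lambda>\<zeta>. cnj \<zeta> / (\<zeta> - z)) has_contour_integral contour_integral Q (kern z) + 2 * pi * \<i> * cnj z) Q"
proof -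
  have zb: "z \<in> box (Complex (-R) (-R)) (Complex R R)"
    using abs_Re_le_cmod[of z] abs_Im_le_cmod[of z] z by (auto simp: in_box_complex_iff)
  have zQ: "z \<notin> path_image Q"
    unfolding Q_def using zb R by (subst path_image_rectpath_cbox_minus_box) auto
  have "((\<lambda>\<zeta>. 1 / (\<zeta> - z)) has_contour_integral (2 * pi * \<i> * winding_number Q z)) Q"
    using zQ unfolding Q_def by (intro has_contour_integral_winding_number) auto
  also have "winding_number Q z = 1" unfolding Q_def by (rule winding_number_rectpath[OF zb])
  finally have "((\<lambda>\<zeta>. cnj z * (1 / (\<zeta> - z))) has_contour_integral (cnj z * (2 * pi * \<i>))) Q"
    by (intro has_contour_integral_lmul) simp
  then have "((\<lambda>\<zeta>. kern z \<zeta> + cnj z * (1 / (\<zeta> - z))) has_contour_integral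
      (contour_integral Q (kern z) + cnj z * (2 * pi * \<i>))) Q"
    unfolding Q_def
    by (intro has_contour_integral_add has_contour_integral_integral
          contour_integrable_rectpath kern_integrable_linepath)
  moreover have "(\<lambda>\<zeta>. kern z \<zeta> + cnj z * (1 / (\<zeta> - z))) = (\<lambda>\<zeta>. cnj \<zeta> / (\<zeta> - z))"
    by (simp add: add_divide_distrib[symmetric])
  ultimately show ?thesis by (simp add: mult_ac)
qed

text \<open>The four edge integrals are holomorphic off the boundary. Holomorphy on a disc larger
  than the one containing \<open>K\<close> makes the integral a uniform limit of polynomials on
  \<open>K\<close>.\<close>

lemma holomorphic_on_square_Cauchy_integral:
  assumes R: "R > 0"
  defines "Q \<equiv> rectpath (Complex (-R) (-R)) (Complex R R)"
  shows "(\<lambda>z. contour_integral Q (\<lambda>\<zeta>. cnj \<zeta> / (\<zeta> - z))) holomorphic_on ball 0 R"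
proof -
  define J where "J a b z = contour_integral (linepath a b) (\<lambda>\<zeta>. cnj \<zeta> / (\<zeta> - z))" for a b z
  have ball: "ball 0 R \<subseteq> - path_image Q"
  proof
    fix z :: complex assume "z \<in> ball 0 R"
    then have "z \<in> box (Complex (-R) (-R)) (Complex R R)"
      using abs_Re_le_cmod[of z] abs_Im_le_cmod[of z] by (auto simp: in_box_complex_iff)
    then show "z \<in> - path_image Q"
      unfolding Q_def using R by (subst path_image_rectpath_cbox_minus_box) auto
  qed
  have J: "J a b holomorphic_on ball 0 R" if "closed_segment a b \<subseteq> path_image Q" for a b
    unfolding J_def
    by (rule holomorphic_on_subset[OF holomorphic_on_linepath_Cauchy_integral])
       (use that ball in \<open>auto intro: continuous_intros\<close>)
  have "(\<lambda>z. J (Complex (-R) (-R)) (Complex R (-R)) z + J (Complex R (-R)) (Complex R R) z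
      - J (Complex (-R) R) (Complex R R) z - J (Complex (-R) (-R)) (Complex (-R) R) z) holomorphic_on ball 0 R"
    by (intro holomorphic_on_add holomorphic_on_diff J)
       (auto simp: Q_def rectpath_def Let_def path_image_join closed_segment_commute)
  then show ?thesis
  proof (rule holomorphic_transform)
    fix z :: complex assume "z \<in> ball 0 R"
    then have "(\<lambda>\<zeta>. cnj \<zeta> / (\<zeta> - z)) contour_integrable_on Q"
      using contour_integral_kern_large_square[OF R, of z] unfolding Q_def contour_integrable_on_def by auto
    from contour_integral_rectpath[OF this[unfolded Q_def]]
    show "J (Complex (-R) (-R)) (Complex R (-R)) z + J (Complex R (-R)) (Complex R R) z
      - J (Complex (-R) R) (Complex R R) z - J (Complex (-R) (-R)) (Complex (-R) R) z
      = contour_integral Q (\<lambda>\<zeta>. cnj \<zeta> / (\<zeta> - z))"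
      by (simp add: J_def Q_def)
  qed
qed

theorem cnj_in_poly_closure:
  assumes K: "compact K" "connected (- K)" "interior K = {}"
  shows "cnj \<in> poly_closure K"
proof (rule poly_closure_uniform_limit)
  fix e :: real assume "e > 0"
  have bK: "bounded K" using K compact_imp_bounded by blast
  then obtain B where B: "B > 0" "\<And>z. z \<in> K \<Longrightarrow> cmod z \<le> B"
    unfolding bounded_pos by auto
  define R where "R = B + 1"
  have R: "R > 0" "B < R" using B(1) by (auto simp: R_def)
  \<comment> \<open>This is the total error for an n by n grid: the side is 2R/n, and each
    coordinate contributes a harmonic sum bounded by 4(1 + ln(n + 1)).\<close>
  have "((\<lambda>n. 70000 * (2 * R / real n) * (4 * (1 + ln (real (Suc n))))\<^sup>2) \<longlongrightarrow> 0) at_top"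
    by real_asymp
  then have "\<forall>\<^sub>F n in at_top. 70000 * (2 * R / real n) * (4 * (1 + ln (real (Suc n))))\<^sup>2 < e"
    using \<open>e > 0\<close> by (rule order_tendstoD)
  from eventually_happens'[OF _ eventually_conj[OF this eventually_gt_at_top[of 0]]]
  obtain n where n: "70000 * (2 * R / real n) * (4 * (1 + ln (real (Suc n))))\<^sup>2 < e" "n > 0"
    by auto
  define d where "d = 2 * R / real n"
  have d: "d > 0" "real n * d = 2 * R" using R n(2) by (auto simp: d_def)
  define X where "X i = - R + real i * d" for i
  define Q where "Q = rectpath (Complex (-R) (-R)) (Complex R R)"
  define I where "I i j z = contour_integral (rectpath (Complex (X i) (X j)) (Complex (X i + d) (X j + d))) (kern z)"
    for i j z
  define E where "E t i = 1 / (1 + \<bar>(t - X i) / d - 1/2\<bar>)" for t i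
  have "\<exists>g. g \<in> poly_closure K \<and> (\<forall>z\<in>K. cmod (I i j z + g z) \<le> 70000 * d * E (Re z) i * E (Im z) j)" for i j
  proof -
    from poly_closure_square_approx[OF K d(1), of "X i" "X j"]
    obtain g where "g \<in> poly_closure K"
      "\<And>z. z \<in> K \<Longrightarrow> cmod (I i j z + g z) \<le> 70000 * d * E (Re z) i * E (Im z) j"
      unfolding I_def E_def by blast
    then show ?thesis by blast
  qed
  then obtain g where g': "\<And>i j. g i j \<in> poly_closure K \<and> (\<forall>z\<in>K. cmod (I i j z + g i j z) \<le> 70000 * d * E (Re z) i * E (Im z) j)"
    by metis
  then have g: "\<And>i j. g i j \<in> poly_closure K"
    "\<And>i j z. z \<in> K \<Longrightarrow> cmod (I i j z + g i j z) \<le> 70000 * d * E (Re z) i * E (Im z) j"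
    by blast+
  have Isum: "(\<Sum>i<n. \<Sum>j<n. I i j z) = contour_integral Q (kern z)" for z
    using contour_integral_grid[OF kern_integrable_linepath[of z],
        where x = "-R" and y = "-R" and d = d and m = n and n = n] d(2)
    by (simp add: I_def X_def Q_def algebra_simps)
  define H where "H z = contour_integral Q (\<lambda>\<zeta>. cnj \<zeta> / (\<zeta> - z))" for z
  have "H holomorphic_on ball 0 R"
    using holomorphic_on_square_Cauchy_integral[OF R(1)] unfolding H_def Q_def .
  then have "H \<in> poly_closure K"
    using poly_closure_compose_holomorphic[OF bK poly_closure_ident _ R(2) B(2)] by simp
  moreover define G where "G z = (\<Sum>i<n. \<Sum>j<n. g i j z)" for z
  ultimately have "(\<lambda>z. inverse (2 * pi * \<i>) * (H z + G z)) \<in> poly_closure K"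
    unfolding G_def
    by (intro poly_closure_mult[OF bK] poly_closure_const poly_closure_add poly_closure_sum g(1))
  moreover have "cmod (cnj z - inverse (2 * pi * \<i>) * (H z + G z)) < e" if z: "z \<in> K" for z
  proof -
    have zR: "cmod z < R" using B(2)[OF z] R by simp
    have "H z = (\<Sum>i<n. \<Sum>j<n. I i j z) + 2 * pi * \<i> * cnj z"
      unfolding Isum H_def Q_def
      using contour_integral_unique[OF contour_integral_kern_large_square[OF R(1) zR]] .
    \<comment> \<open>Solving for \<open>cnj z\<close> leaves only the cellwise errors, which are
      summed by the product bound.\<close>
    then have "cnj z - inverse (2 * pi * \<i>) * (H z + G z)
        = - inverse (2 * pi * \<i>) * (\<Sum>i<n. \<Sum>j<n. I i j z + g i j z)"
      by (simp add: G_def sum.distrib field_simps)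
    moreover have "cmod (- inverse (2 * pi * \<i>)) = inverse (2 * pi)"
      by (simp add: norm_mult norm_inverse)
    ultimately have "cmod (cnj z - inverse (2 * pi * \<i>) * (H z + G z))
        = inverse (2 * pi) * cmod (\<Sum>i<n. \<Sum>j<n. I i j z + g i j z)"
      by (simp only: norm_mult)
    also have "\<dots> \<le> 1 * (\<Sum>i<n. \<Sum>j<n. 70000 * d * E (Re z) i * E (Im z) j)"
    proof (intro mult_mono order_trans[OF norm_sum] sum_mono g(2) z)
      show "inverse (2 * pi) \<le> 1" using le_imp_inverse_le[of 1 "2 * pi"] pi_ge_two by simp
    qed auto
    also have "\<dots> = 70000 * d * ((\<Sum>i<n. E (Re z) i) * (\<Sum>j<n. E (Im z) j))"
      by (simp only: sum_product) (simp add: sum_distrib_left mult.assoc)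
    also have "\<dots> \<le> 70000 * d * ((4 * (1 + ln (real (Suc n)))) * (4 * (1 + ln (real (Suc n)))))"
    proof -
      \<comment> \<open>The sequence harm n - ln n decreases and has the value 1 at n = 1.\<close>
      have "harm (Suc n) \<le> 1 + ln (real (Suc n))"
        using euler_mascheroni_sequence_decreasing[of 1 "Suc n"] by (simp add: harm_expand)
      moreover have "(\<Sum>i<n. E t i) \<le> 4 * harm (Suc n)" if "\<bar>t\<bar> < R" for t
      proof -
        have eq: "(t - X i) / d - 1/2 = ((t + R) / d - 1/2) - real i" for i
          using d(1) by (simp add: X_def field_simps)
        have "0 \<le> (t + R) / d" "(t + R) / d \<le> real n"
          using that d by (auto simp: divide_le_eq)
        then show ?thesis
          unfolding E_def eq by (intro sum_inverse_dist_le) linarith+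
      qed
      ultimately have *: "(\<Sum>i<n. E t i) \<le> 4 * (1 + ln (real (Suc n)))" if "\<bar>t\<bar> < R" for t
        using that by fastforce
      have "0 \<le> E t i" for t i by (simp add: E_def)
      then show ?thesis
        using d(1) abs_Re_le_cmod[of z] abs_Im_le_cmod[of z] zR
        by (intro mult_left_mono mult_mono * sum_nonneg) auto
    qed
    also have "\<dots> < e" using n(1) by (simp add: d_def power2_eq_square)
    finally show ?thesis .
  qed
  ultimately show "\<exists>g\<in>poly_closure K. \<forall>z\<in>K. cmod (cnj z - g z) < e"
    by (intro bexI[of _ "\<lambda>z. inverse (2 * pi * \<i>) * (H z + G z)"] ballI)
qed

subsection \<open>Spectrum and polynomial calculus in complex Banach algebras\<close>

lemma Neumann_inverse:
  fixes a :: "'a::{real_normed_algebra_1,banach}"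
  assumes "norm a < 1"
  shows "\<exists>u. u * (1 - a) = 1 \<and> (1 - a) * u = 1"
proof -
  have sum: "summable (\<lambda>n. a ^ n)"
    by (rule summable_comparison_test'[OF summable_geometric[of "norm a"], of 0])
       (use assms in \<open>auto intro: norm_power_ineq\<close>)
  define u where "u = (\<Sum>n. a ^ n)"
  have "u = 1 + (\<Sum>n. a ^ Suc n)"
    using suminf_split_head[OF sum] by (simp add: u_def)
  moreover have "(\<Sum>n. a ^ Suc n) = a * u" "(\<Sum>n. a ^ Suc n) = u * a"
    using suminf_mult[OF sum, of a] suminf_mult2[OF sum, of a]
    by (simp_all add: u_def power_Suc2 del: power_Suc) (simp add: power_commutes)
  ultimately have "u = 1 + a * u" "u = 1 + u * a" by simp_all
  then show ?thesis
    by (intro exI[of _ u]) (simp add: algebra_simps)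
qed

text \<open>This is the partial fraction 1/(1 - a^2) = (1/(1 - a) + 1/(1 + a))/2, valid here because
  1 - a and 1 + a commute.\<close>

lemma average_inverse:
  fixes a :: "'a::real_algebra_1"
  assumes "u * (1 - a) = 1" "(1 - a) * u = 1" "v * (1 + a) = 1" "(1 + a) * v = 1"
  shows "((1/2) *\<^sub>R (u + v)) * (1 - a * a) = 1" "(1 - a * a) * ((1/2) *\<^sub>R (u + v)) = 1"
proof -
  have f: "1 - a * a = (1 - a) * (1 + a)" "1 - a * a = (1 + a) * (1 - a)"
    by (simp_all add: algebra_simps)
  have "u * (1 - a * a) = 1 + a" "(1 - a * a) * v = 1 - a"
    using assms(1,4) by (metis f(1) mult.assoc mult_1_left mult_1_right)+
  moreover have "(1 - a * a) * u = 1 + a" "v * (1 - a * a) = 1 - a"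
    using assms(2,3) by (metis f(2) mult.assoc mult_1_left mult_1_right)+
  ultimately show "((1/2) *\<^sub>R (u + v)) * (1 - a * a) = 1" "(1 - a * a) * ((1/2) *\<^sub>R (u + v)) = 1"
    by (simp_all add: distrib_right distrib_left flip: scaleR_2)
qed

text \<open>Everything follows from the resolvent identity u - v = v (a - b) u; the smallness
  hypothesis first absorbs \<open>v\<close> into \<open>u\<close>.\<close>

lemma inverse_perturbation:
  fixes a b :: "'a::real_normed_algebra_1"
  assumes u: "(1 - a) * u = 1" and v: "v * (1 - b) = 1" and ab: "norm (a - b) * norm u \<le> 1/2"
  shows "norm v \<le> 2 * norm u" "norm (u - v) \<le> 2 * (norm u)\<^sup>2 * norm (a - b)"
proof -
  have "v * (p - q) * u = (v * p) * u - v * (q * u)" for p q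
    by (simp add: algebra_simps)
  from this[of "1 - b" "1 - a"] have eq: "u - v = v * (a - b) * u"
    using u v by simp
  have le: "norm (u - v) \<le> norm v * (norm (a - b) * norm u)"
    unfolding eq using norm_mult_ineq[of "v * (a - b)" u]
      mult_right_mono[OF norm_mult_ineq[of v "a - b"], of "norm u"] by (simp add: mult.assoc)
  also have "\<dots> \<le> norm v * (1/2)" using ab by (intro mult_left_mono) auto
  finally show *: "norm v \<le> 2 * norm u"
    using norm_triangle_ineq2[of v u] by (simp add: norm_minus_commute)
  have "norm v * (norm (a - b) * norm u) \<le> (2 * norm u) * (norm (a - b) * norm u)"
    by (intro mult_right_mono *) auto
  with le show "norm (u - v) \<le> 2 * (norm u)\<^sup>2 * norm (a - b)"
    by (simp add: power2_eq_square mult_ac)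
qed

text \<open>Testing with t = x/(C + 1) leaves t^2 \<le> 0.\<close>

lemma linear_le_quadratic_imp_zero:
  fixes x C :: real
  assumes "C \<ge> 0" "\<And>t. t * x \<le> C * t\<^sup>2"
  shows "x = 0"
proof -
  define t where "t = x / (C + 1)"
  have x: "x = t * (C + 1)" using assms(1) by (simp add: t_def)
  have "t * x \<le> C * t\<^sup>2" by (rule assms(2))
  then have "t\<^sup>2 \<le> 0" by (simp add: x power2_eq_square algebra_simps)
  then show ?thesis by (simp add: x)
qed

locale complex_algebra =
  fixes sc :: "complex \<Rightarrow> 'a::{real_normed_algebra_1,banach} \<Rightarrow> 'a"
  assumes scalars: "complex_scalars sc"
begin

lemma sc_of_real: "sc (complex_of_real r) x = r *\<^sub>R x"
  and sc_add_right: "sc a (x + y) = sc a x + sc a y"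
  and sc_add_left: "sc (a + b) x = sc a x + sc b x"
  and sc_sc [simp]: "sc a (sc b x) = sc (a * b) x"
  and sc_mult_left: "sc a x * y = sc a (x * y)"
  and sc_mult_right: "x * sc a y = sc a (x * y)"
  and norm_sc [simp]: "norm (sc a x) = cmod a * norm x"
proof -
  note sc = scalars[unfolded complex_scalars_def]
  from sc show "sc (complex_of_real r) x = r *\<^sub>R x" by (elim conjE) iprover
  from sc show "sc a (x + y) = sc a x + sc a y" by (elim conjE) iprover
  from sc show "sc (a + b) x = sc a x + sc b x" by (elim conjE) iprover
  from sc show "sc a (sc b x) = sc (a * b) x" by (elim conjE) iprover
  from sc show "sc a x * y = sc a (x * y)" by (elim conjE) (rule sym, iprover)
  from sc show "x * sc a y = sc a (x * y)" by (elim conjE) (rule sym, iprover)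
  from sc show "norm (sc a x) = cmod a * norm x" by (elim conjE) iprover
qed

lemma sc_1 [simp]: "sc 1 x = x" and sc_0 [simp]: "sc 0 x = 0"
  using sc_of_real[of 1 x] sc_of_real[of 0 x] by simp_all

lemma sc_0_right [simp]: "sc a 0 = 0"
  using sc_add_right[of a 0 0] by simp

lemma sc_minus_left: "sc (- a) x = - sc a x"
  using sc_add_left[of "- a" a x] by (simp add: eq_neg_iff_add_eq_0)

lemma sc_minus_right: "sc a (- x) = - sc a x"
  using sc_add_right[of a "- x" x] by (simp add: eq_neg_iff_add_eq_0)

lemma sc_diff_right: "sc a (x - y) = sc a x - sc a y"
  using sc_add_right[of a x "- y"] by (simp add: sc_minus_right)

lemma sc_diff_left: "sc (a - b) x = sc a x - sc b x"
  using sc_add_left[of a "- b" x] by (simp add: sc_minus_left)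

lemma sc_sum_right: "sc a (\<Sum>i\<in>I. f i) = (\<Sum>i\<in>I. sc a (f i))"
  by (induction I rule: infinite_finite_induct) (auto simp: sc_add_right)

lemma tendsto_sc:
  assumes "(f \<longlongrightarrow> l) F"
  shows "((\<lambda>n. sc c (f n)) \<longlongrightarrow> sc c l) F"
proof -
  have "((\<lambda>n. cmod c * norm (f n - l)) \<longlongrightarrow> 0) F"
    by (rule tendsto_mult_right_zero[OF tendsto_norm_zero[OF LIM_zero[OF assms]]])
  then have "((\<lambda>n. norm (sc c (f n) - sc c l)) \<longlongrightarrow> 0) F"
    by (simp flip: sc_diff_right)
  then show ?thesis by (rule LIM_zero_cancel[OF tendsto_norm_zero_cancel])
qed

section \<open>Invertibility and points of maximal modulus in the spectrum\<close>

lemma invertible_sc: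
  assumes "c \<noteq> 0"
  shows "invertible_elem (sc c x) \<longleftrightarrow> invertible_elem x"
proof -
  have "invertible_elem (sc c x)" if "c \<noteq> 0" "invertible_elem x" for c x
  proof -
    from that(2) obtain y where "x * y = 1" "y * x = 1" unfolding invertible_elem_def by blast
    then show ?thesis unfolding invertible_elem_def using that(1)
      by (intro exI[of _ "sc (inverse c) y"]) (simp add: sc_mult_left sc_mult_right)
  qed
  from this[of c x] this[of "inverse c" "sc c x"] assms show ?thesis by auto
qed

lemma spec_elem_norm_le:
  assumes "z \<in> spec_elem sc x"
  shows "cmod z \<le> norm x"
proof (rule ccontr)
  assume "\<not> ?thesis"
  then have xz: "norm x < cmod z" by simp
  have "norm (sc (inverse z) x) = norm x / cmod z"
    by (simp only: norm_sc norm_inverse divide_inverse mult.commute)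
  also have "\<dots> < 1"
    using xz le_less_trans[OF norm_ge_zero xz] by (simp only: divide_less_eq_1_pos)
  finally have z: "z \<noteq> 0" "norm (sc (inverse z) x) < 1"
    using xz norm_ge_zero[of x] by auto
  from Neumann_inverse[OF z(2)] have "invertible_elem (1 - sc (inverse z) x)"
    unfolding invertible_elem_def by blast
  then have "invertible_elem (sc (- z) (1 - sc (inverse z) x))"
    using z by (subst invertible_sc) auto
  also have "sc (- z) (1 - sc (inverse z) x) = x - sc z 1"
    using z by (simp add: sc_diff_right sc_minus_left)
  finally show False using assms by (simp add: spec_elem_def)
qed

text \<open>Rickart's elementary argument for the spectral radius formula, along powers of 2: if no point of the unit circle
  is in the spectrum of \<open>y\<close>, averaging resolvents over \<open>\<plusminus>\<eta>\<close> carries a uniform estimate for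
  \<open>(1 - \<omega> y)\<inverse> - (1 - r \<omega> y)\<inverse>\<close> over to all the powers \<open>y\<^bsup>2^m\<^esup>\<close>.\<close>
lemma resolvents_close_power2:
  assumes base: "\<And>\<omega>. cmod \<omega> = 1 \<Longrightarrow> \<exists>u v. u * (1 - sc \<omega> y) = 1 \<and> (1 - sc \<omega> y) * u = 1 \<and>
      v * (1 - sc (of_real r * \<omega>) y) = 1 \<and> (1 - sc (of_real r * \<omega>) y) * v = 1 \<and> norm (u - v) \<le> \<epsilon>"
    and "cmod \<omega> = 1"
  shows "\<exists>u v. u * (1 - sc \<omega> (y ^ 2 ^ m)) = 1 \<and> (1 - sc \<omega> (y ^ 2 ^ m)) * u = 1 \<and>
      v * (1 - sc (of_real (r ^ 2 ^ m) * \<omega>) (y ^ 2 ^ m)) = 1 \<and>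
      (1 - sc (of_real (r ^ 2 ^ m) * \<omega>) (y ^ 2 ^ m)) * v = 1 \<and> norm (u - v) \<le> \<epsilon>"
  using assms(2)
proof (induction m arbitrary: \<omega>)
  case 0
  then show ?case using base by simp
next
  case (Suc m)
  define \<eta> where "\<eta> = csqrt \<omega>"
  have \<eta>: "\<eta> * \<eta> = \<omega>" by (simp add: \<eta>_def flip: power2_eq_square)
  then have n\<eta>: "cmod \<eta> = 1" "cmod (- \<eta>) = 1"
    using Suc.prems by (auto simp: \<eta>_def)
  define Y where "Y = y ^ 2 ^ m"
  define \<rho> where "\<rho> = complex_of_real (r ^ 2 ^ m)"
  have YY: "y ^ 2 ^ Suc m = Y * Y" by (simp add: Y_def mult_2 flip: power_add)
  have \<rho>\<rho>: "complex_of_real (r ^ 2 ^ Suc m) = \<rho> * \<rho>" by (simp add: \<rho>_def mult_2 flip: power_add)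
  obtain u1 v1 where 1: "u1 * (1 - sc \<eta> Y) = 1" "(1 - sc \<eta> Y) * u1 = 1"
      "v1 * (1 - sc (\<rho> * \<eta>) Y) = 1" "(1 - sc (\<rho> * \<eta>) Y) * v1 = 1" "norm (u1 - v1) \<le> \<epsilon>"
    using Suc.IH[OF n\<eta>(1)] unfolding Y_def \<rho>_def by blast
  obtain u2 v2 where 2: "u2 * (1 + sc \<eta> Y) = 1" "(1 + sc \<eta> Y) * u2 = 1"
      "v2 * (1 + sc (\<rho> * \<eta>) Y) = 1" "(1 + sc (\<rho> * \<eta>) Y) * v2 = 1" "norm (u2 - v2) \<le> \<epsilon>"
    using Suc.IH[OF n\<eta>(2)] unfolding Y_def \<rho>_def by (auto simp: sc_minus_left)
  have sq: "sc \<eta> Y * sc \<eta> Y = sc \<omega> (Y * Y)" "sc (\<rho> * \<eta>) Y * sc (\<rho> * \<eta>) Y = sc (\<rho> * \<rho> * \<omega>) (Y * Y)"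
    by (simp_all add: sc_mult_left sc_mult_right mult_ac flip: \<eta>)
  have "norm ((1/2) *\<^sub>R (u1 + u2) - (1/2) *\<^sub>R (v1 + v2)) = norm ((1/2) *\<^sub>R ((u1 - v1) + (u2 - v2)))"
    by (simp add: algebra_simps)
  also have "\<dots> \<le> (norm (u1 - v1) + norm (u2 - v2)) / 2"
    using norm_triangle_ineq[of "u1 - v1" "u2 - v2"] by simp
  also have "\<dots> \<le> \<epsilon>" using 1 2 by simp
  finally show ?case
    unfolding YY \<rho>\<rho> using average_inverse[OF 1(1,2) 2(1,2)] average_inverse[OF 1(3,4) 2(3,4)]
    unfolding sq by blast
qed

text \<open>By \<open>inverse_perturbation\<close> the resolvent at one point bounds it on a
  neighbourhood, and finitely many such neighbourhoods cover the circle.\<close>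

lemma resolvent_bounded_on_circle:
  assumes y: "norm y = 1" and inv: "\<And>\<omega>. cmod \<omega> = 1 \<Longrightarrow> \<exists>u. u * (1 - sc \<omega> y) = 1 \<and> (1 - sc \<omega> y) * u = 1"
  obtains M where "M \<ge> 1"
    "\<And>\<omega> u. cmod \<omega> = 1 \<Longrightarrow> u * (1 - sc \<omega> y) = 1 \<Longrightarrow> (1 - sc \<omega> y) * u = 1 \<Longrightarrow> norm u \<le> M"
proof -
  obtain R where R: "\<And>\<omega>. cmod \<omega> = 1 \<Longrightarrow> R \<omega> * (1 - sc \<omega> y) = 1 \<and> (1 - sc \<omega> y) * R \<omega> = 1"
    using inv by metis
  \<comment> \<open>The radius makes \<open>\<delta> \<omega> * (norm (R \<omega>) + 1)\<close>
    equal to 1/2, the threshold of \<open>inverse_perturbation\<close>.\<close>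
  define \<delta> where "\<delta> \<omega> = 1 / (2 * (norm (R \<omega>) + 1))" for \<omega>
  have \<delta>: "\<delta> \<omega> > 0" for \<omega> unfolding \<delta>_def by (intro divide_pos_pos mult_pos_pos add_nonneg_pos) auto
  have "compact (sphere (0::complex) 1)" by simp
  moreover have "\<And>\<omega>. \<omega> \<in> sphere (0::complex) 1 \<Longrightarrow> open (ball \<omega> (\<delta> \<omega>))" by simp
  moreover have "sphere (0::complex) 1 \<subseteq> (\<Union>\<omega>\<in>sphere 0 1. ball \<omega> (\<delta> \<omega>))"
    using \<delta> by auto
  ultimately obtain C where C: "C \<subseteq> sphere 0 1" "finite C" "sphere 0 1 \<subseteq> (\<Union>\<omega>\<in>C. ball \<omega> (\<delta> \<omega>))"
    by (rule compactE_image)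
  define M where "M = 1 + (\<Sum>\<omega>\<in>C. 2 * norm (R \<omega>))"
  show ?thesis
  proof (rule that)
    show "M \<ge> 1" unfolding M_def by (auto intro: sum_nonneg)
    fix \<omega> u assume \<omega>: "cmod \<omega> = 1" and u: "u * (1 - sc \<omega> y) = 1" "(1 - sc \<omega> y) * u = 1"
    have "\<omega> \<in> (\<Union>\<omega>\<in>C. ball \<omega> (\<delta> \<omega>))" by (rule subsetD[OF C(3)]) (use \<omega> in simp)
    then obtain \<omega>0 where \<omega>0: "\<omega>0 \<in> C" "cmod (\<omega>0 - \<omega>) < \<delta> \<omega>0"
      by (auto simp: dist_norm)
    have "cmod \<omega>0 = 1" using \<omega>0(1) C(1) by auto
    have "norm (sc \<omega>0 y - sc \<omega> y) * norm (R \<omega>0) = cmod (\<omega>0 - \<omega>) * norm (R \<omega>0)"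
      using y by (simp flip: sc_diff_left)
    also have "\<dots> \<le> \<delta> \<omega>0 * (norm (R \<omega>0) + 1)"
      using \<omega>0(2) less_imp_le[OF \<delta>] by (intro mult_mono) auto
    also have "\<dots> = 1/2" 
    proof -
      have "norm (R \<omega>0) + 1 > 0" by (intro add_nonneg_pos) auto
      then show ?thesis unfolding \<delta>_def by simp
    qed
    finally have "norm u \<le> 2 * norm (R \<omega>0)"
      using inverse_perturbation(1)[of "sc \<omega>0 y" "R \<omega>0" u "sc \<omega> y"] R[OF \<open>cmod \<omega>0 = 1\<close>] u by blast
    also have "\<dots> \<le> (\<Sum>\<omega>\<in>C. 2 * norm (R \<omega>))"
      using \<omega>0(1) C(2) by (intro member_le_sum) auto
    finally show "norm u \<le> M" by (simp add: M_def)
  qed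
qed

text \<open>Otherwise the inverses of 1 - Y and 1 - r^(2^m) Y stay close for all Y = y^(2^m). The
  second tends to 1, so the first is eventually close to 1, which contradicts norm Y = 1.\<close>

lemma unit_circle_meets_spec:
  assumes y: "\<And>m. norm (y ^ 2 ^ m) = 1"
  shows "\<exists>z\<in>spec_elem sc y. cmod z = 1"
proof (rule ccontr)
  assume no: "\<not> ?thesis"
  have y1: "norm y = 1" using y[of 0] by simp
  have inv: "\<exists>u. u * (1 - sc \<omega> y) = 1 \<and> (1 - sc \<omega> y) * u = 1" if "cmod \<omega> = 1" for \<omega>
  proof -
    have "\<omega> \<noteq> 0" using that by auto
    have "inverse \<omega> \<notin> spec_elem sc y" using no that by (auto simp: norm_inverse)
    then have "invertible_elem (y - sc (inverse \<omega>) 1)" by (simp add: spec_elem_def)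
    then have "invertible_elem (sc (- \<omega>) (y - sc (inverse \<omega>) 1))"
      using \<open>\<omega> \<noteq> 0\<close> by (subst invertible_sc) auto
    also have "sc (- \<omega>) (y - sc (inverse \<omega>) 1) = 1 - sc \<omega> y"
      using \<open>\<omega> \<noteq> 0\<close> by (simp add: sc_diff_right sc_minus_left)
    finally show ?thesis unfolding invertible_elem_def by blast
  qed
  from resolvent_bounded_on_circle[OF y1 inv] obtain M where M: "M \<ge> 1"
    "\<And>\<omega> u. cmod \<omega> = 1 \<Longrightarrow> u * (1 - sc \<omega> y) = 1 \<Longrightarrow> (1 - sc \<omega> y) * u = 1 \<Longrightarrow> norm u \<le> M"
    by blast
  \<comment> \<open>With this \<open>r\<close> the resolvent estimate 2 M^2 (1 - r) equals
    1/8.\<close>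
  define r where "r = 1 - 1 / (16 * M\<^sup>2)"
  have MM: "M \<le> M\<^sup>2" "1 \<le> M\<^sup>2" using M(1) by (auto simp: power2_eq_square intro: order_trans)
  have "1 < 16 * M\<^sup>2" using MM by linarith
  then have r: "0 < r" "r < 1" using M(1) by (auto simp: r_def divide_less_eq)
  have close: "\<exists>u v. u * (1 - sc \<omega> y) = 1 \<and> (1 - sc \<omega> y) * u = 1 \<and>
      v * (1 - sc (of_real r * \<omega>) y) = 1 \<and> (1 - sc (of_real r * \<omega>) y) * v = 1 \<and> norm (u - v) \<le> 1/8"
    if \<omega>: "cmod \<omega> = 1" for \<omega>
  proof -
    obtain u where u: "u * (1 - sc \<omega> y) = 1" "(1 - sc \<omega> y) * u = 1" using inv[OF \<omega>] by blast
    have "norm (sc (of_real r * \<omega>) y) < 1" using \<omega> y1 r by (simp add: norm_mult)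
    from Neumann_inverse[OF this] obtain v where
      v: "v * (1 - sc (of_real r * \<omega>) y) = 1" "(1 - sc (of_real r * \<omega>) y) * v = 1" by blast
    have uM: "norm u \<le> M" using M(2)[OF \<omega> u] .
    have "sc \<omega> y - sc (of_real r * \<omega>) y = sc (of_real (1 - r) * \<omega>) y"
      by (simp add: algebra_simps flip: sc_diff_left)
    then have "norm (sc \<omega> y - sc (of_real r * \<omega>) y) = 1 - r"
      using \<omega> y1 r by (simp add: norm_mult del: of_real_diff)
    then have nab: "norm (sc \<omega> y - sc (of_real r * \<omega>) y) = 1 / (16 * M\<^sup>2)"
      by (simp add: r_def)
    have "1 / (16 * M\<^sup>2) * norm u \<le> 1 / (16 * M\<^sup>2) * M\<^sup>2"
      using uM MM by (intro mult_left_mono) auto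
    also have "\<dots> \<le> 1/2" using MM by simp
    finally have "norm (sc \<omega> y - sc (of_real r * \<omega>) y) * norm u \<le> 1/2" by (simp add: nab)
    from inverse_perturbation(2)[OF u(2) v(1) this]
    have "norm (u - v) \<le> 2 * (norm u)\<^sup>2 * (1 / (16 * M\<^sup>2))" by (simp only: nab)
    also have "\<dots> \<le> 2 * M\<^sup>2 * (1 / (16 * M\<^sup>2))"
      using uM by (intro mult_right_mono mult_left_mono power_mono) auto
    also have "\<dots> = 1/8" using M(1) by simp
    finally show ?thesis using u v by blast
  qed
  have "(\<lambda>n. r ^ n) \<longlonglongrightarrow> 0" using r by (intro LIMSEQ_power_zero) auto
  then have "\<forall>\<^sub>F n in sequentially. r ^ n < 1/16" by (rule order_tendstoD) auto
  then obtain N where N: "\<And>n. n \<ge> N \<Longrightarrow> r ^ n < 1/16" by (auto simp: eventually_sequentially)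
  define Y where "Y = y ^ 2 ^ N"
  have rN: "r ^ 2 ^ N < 1/16" by (rule N) (simp add: less_imp_le)
  obtain u v where u: "u * (1 - Y) = 1" and v: "v * (1 - sc (of_real (r ^ 2 ^ N)) Y) = 1"
    and uv: "norm (u - v) \<le> 1/8"
    using resolvents_close_power2[OF close, of 1 N] unfolding Y_def by auto
  have "norm Y = 1" unfolding Y_def by (rule y)
  define a where "a = sc (of_real (r ^ 2 ^ N)) Y"
  have a: "norm a \<le> 1/16" using rN r \<open>norm Y = 1\<close> by (simp add: a_def norm_power)
  have v1: "v - 1 = v * a" using v by (simp add: a_def right_diff_distrib diff_eq_eq eq_diff_eq add.commute)
  have "norm (v - 1) \<le> norm v * (1/16)"
    unfolding v1 using a norm_mult_ineq[of v a] by (smt (verit) mult_left_mono norm_ge_zero)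
  moreover have "norm v \<le> norm (v - 1) + 1" using norm_triangle_ineq[of "v - 1" 1] by simp
  ultimately have "norm (v - 1) \<le> 1/8" by linarith
  with uv have u1: "norm (u - 1) \<le> 1/4" using norm_triangle_ineq[of "u - v" "v - 1"] by simp
  \<comment> \<open>This is (u - 1)(1 - Y) = Y; with norm (u - 1) at most 1/4 it bounds the norm of
    \<open>Y\<close> by 1/2.\<close>
  have Y: "(u - 1) - (u - 1) * Y = Y" using u by (simp add: algebra_simps)
  have "norm Y \<le> norm (u - 1) + norm ((u - 1) * Y)"
    using norm_triangle_ineq4[of "u - 1" "(u - 1) * Y"] unfolding Y .
  also have "\<dots> \<le> norm (u - 1) + norm (u - 1) * norm Y"
    by (intro add_left_mono norm_mult_ineq)
  finally have "norm Y \<le> norm (u - 1) + norm (u - 1) * norm Y" .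
  with u1 \<open>norm Y = 1\<close> show False by simp
qed

lemma norm_attained_in_spec:
  assumes x: "\<And>m. norm (x ^ 2 ^ m) = norm x ^ 2 ^ m"
  shows "\<exists>z\<in>spec_elem sc x. cmod z = norm x"
proof (cases "x = 0")
  case True
  then show ?thesis by (intro bexI[of _ 0]) (auto simp: spec_elem_def invertible_elem_def)
next
  case False
  define y where "y = sc (of_real (inverse (norm x))) x"
  have ypow: "y ^ n = sc (of_real (inverse (norm x) ^ n)) (x ^ n)" for n
    by (induction n) (simp_all add: y_def sc_mult_left sc_mult_right mult_ac)
  have "norm (y ^ 2 ^ m) = 1" for m
    using False by (simp add: ypow x norm_power norm_inverse power_inverse)
  from unit_circle_meets_spec[OF this] obtain z where z: "z \<in> spec_elem sc y" "cmod z = 1" by blast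
  have "x - sc (of_real (norm x) * z) 1 = sc (of_real (norm x)) (y - sc z 1)"
    using False by (simp add: y_def sc_diff_right flip: of_real_mult)
  then have "of_real (norm x) * z \<in> spec_elem sc x"
    using z(1) False by (simp add: spec_elem_def invertible_sc)
  then show ?thesis using z(2) by (intro bexI[of _ "of_real (norm x) * z"]) (auto simp: norm_mult)
qed

section \<open>Polynomials of an element and their spectra\<close>

lemma poly_eval_upto:
  assumes "degree p \<le> n"
  shows "poly_eval sc p x = (\<Sum>k\<le>n. sc (coeff p k) (x ^ k))"
  unfolding poly_eval_def
  by (rule sum.mono_neutral_left) (use assms in \<open>auto simp: coeff_eq_0\<close>)

lemma poly_eval_add: "poly_eval sc (p + q) x = poly_eval sc p x + poly_eval sc q x"
  using poly_eval_upto[of p "max (degree p) (degree q)" x] poly_eval_upto[of q "max (degree p) (degree q)" x]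
    poly_eval_upto[of "p + q" "max (degree p) (degree q)" x]
  by (simp add: degree_add_le_max sc_add_left sum.distrib)

lemma poly_eval_smult: "poly_eval sc (smult c p) x = sc c (poly_eval sc p x)"
  using poly_eval_upto[of "smult c p" "degree p" x] by (simp add: poly_eval_def sc_sum_right)

lemma poly_eval_0 [simp]: "poly_eval sc 0 x = 0"
  by (simp add: poly_eval_def)

lemma poly_eval_pCons: "poly_eval sc (pCons a p) x = sc a 1 + x * poly_eval sc p x"
proof -
  have "poly_eval sc (pCons a p) x = (\<Sum>k\<le>Suc (degree p). sc (coeff (pCons a p) k) (x ^ k))"
    by (rule poly_eval_upto) (simp add: degree_pCons_le)
  also have "\<dots> = sc a 1 + (\<Sum>k\<le>degree p. sc (coeff p k) (x ^ Suc k))"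
    by (subst sum.atMost_Suc_shift) simp
  finally show ?thesis by (simp add: poly_eval_def sum_distrib_left sc_mult_right)
qed

lemma poly_eval_mult: "poly_eval sc (p * q) x = poly_eval sc p x * poly_eval sc q x"
  by (induction p)
     (simp_all add: poly_eval_pCons poly_eval_add poly_eval_smult distrib_right sc_mult_left mult.assoc)

lemma poly_eval_diff: "poly_eval sc (p - q) x = poly_eval sc p x - poly_eval sc q x"
  using poly_eval_add[of "p - q" q x] by simp

lemma poly_eval_commute:
  assumes "y * x = x * y"
  shows "y * poly_eval sc p x = poly_eval sc p x * y"
proof (induction p)
  case (pCons a p)
  have "y * (x * poly_eval sc p x) = x * poly_eval sc p x * y"
    using assms pCons.IH by (metis mult.assoc)
  then show ?case by (simp add: poly_eval_pCons distrib_left distrib_right sc_mult_left sc_mult_right)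
qed auto

text \<open>Split off a root \<open>a\<close> of \<open>q\<close>. If \<open>a\<close> is not in the
  spectrum, the factor \<open>x - sc a 1\<close> is invertible, so non-invertibility passes to the
  quotient of lower degree.\<close>

lemma poly_eval_not_invertible_imp_root:
  assumes "q \<noteq> 0" "\<not> invertible_elem (poly_eval sc q x)"
  shows "\<exists>a\<in>spec_elem sc x. poly q a = 0"
  using assms
proof (induction "degree q" arbitrary: q)
  case 0
  then obtain c where c: "q = [:c:]" using degree_eq_zeroE by metis
  have "invertible_elem (1::'a)" unfolding invertible_elem_def by (intro exI[of _ 1]) simp
  then have "invertible_elem (poly_eval sc q x)"
    using 0(2) by (simp add: c poly_eval_pCons invertible_sc)
  with 0 show ?case by simp
next
  case (Suc n)
  then obtain a where a: "poly q a = 0"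
    using fundamental_theorem_of_algebra constant_degree by (metis nat.simps(3))
  then obtain q' where q': "q = [:- a, 1:] * q'" using poly_eq_0_iff_dvd dvdE by metis
  show ?case
  proof (cases "a \<in> spec_elem sc x")
    case True
    with a show ?thesis by blast
  next
    case False
    then obtain w where w: "(x - sc a 1) * w = 1" "w * (x - sc a 1) = 1"
      by (auto simp: spec_elem_def invertible_elem_def)
    have ev: "poly_eval sc q x = (x - sc a 1) * poly_eval sc q' x"
      by (simp only: q' poly_eval_mult) (simp add: poly_eval_pCons sc_minus_left)
    have "\<not> invertible_elem (poly_eval sc q' x)"
    proof
      assume "invertible_elem (poly_eval sc q' x)"
      then obtain v where v: "poly_eval sc q' x * v = 1" "v * poly_eval sc q' x = 1"
        by (auto simp: invertible_elem_def)
      have "poly_eval sc q x * (v * w) = 1" "(v * w) * poly_eval sc q x = 1"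
        unfolding ev using v w by (metis mult.assoc mult_1_left)+
      with Suc.prems show False by (auto simp: invertible_elem_def)
    qed
    moreover have "q' \<noteq> 0" using Suc.prems q' by auto
    moreover have "degree q = Suc (degree q')"
      using \<open>q' \<noteq> 0\<close> unfolding q' by (subst degree_mult_eq) auto
    ultimately show ?thesis using Suc by (auto simp: q')
  qed
qed

text \<open>One half of the spectral mapping theorem, from the roots of p - \<mu>. Nonemptiness of
  the spectrum covers the constant polynomial p = \<mu>.\<close>

lemma spec_poly_eval:
  assumes "\<mu> \<in> spec_elem sc (poly_eval sc p x)" "spec_elem sc x \<noteq> {}"
  shows "\<exists>a\<in>spec_elem sc x. poly p a = \<mu>"
proof (cases "p = [:\<mu>:]")
  case True
  then show ?thesis using assms(2) by auto
next
  case False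
  have "poly_eval sc (p - [:\<mu>:]) x = poly_eval sc p x - sc \<mu> 1"
    by (simp add: poly_eval_diff poly_eval_pCons)
  then have "\<not> invertible_elem (poly_eval sc (p - [:\<mu>:]) x)"
    using assms(1) by (simp add: spec_elem_def)
  from poly_eval_not_invertible_imp_root[OF _ this] False show ?thesis by auto
qed

end

subsection \<open>Normal and self-adjoint elements\<close>

locale cstar_algebra =
  fixes sc :: "complex \<Rightarrow> 'a::{real_normed_algebra_1,banach} \<Rightarrow> 'a" and st :: "'a \<Rightarrow> 'a"
  assumes cstar: "unital_cstar_algebra sc st"
begin

sublocale complex_algebra sc
  by unfold_locales (use cstar in \<open>simp add: unital_cstar_algebra_def\<close>)

lemma st_st [simp]: "st (st x) = x"
  and st_add: "st (x + y) = st x + st y"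
  and st_sc: "st (sc a x) = sc (cnj a) (st x)"
  and st_mult: "st (x * y) = st y * st x"
  and norm_st_mult: "norm (st x * x) = (norm x)\<^sup>2"
proof -
  note c = cstar[unfolded unital_cstar_algebra_def]
  from c show "st (st x) = x" by (elim conjE) iprover
  from c show "st (x + y) = st x + st y" by (elim conjE) iprover
  from c show "st (sc a x) = sc (cnj a) (st x)" by (elim conjE) iprover
  from c show "st (x * y) = st y * st x" by (elim conjE) iprover
  from c show "norm (st x * x) = (norm x)\<^sup>2" by (elim conjE) iprover
qed

lemma st_1 [simp]: "st 1 = 1"
  using st_mult[of "st 1" 1] by simp

lemma st_minus: "st (- x) = - st x"
  using st_sc[of "-1" x] by (simp add: sc_minus_left)

lemma st_diff: "st (x - y) = st x - st y"
  using st_add[of x "- y"] by (simp add: st_minus)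

text \<open>Normality regroups the C*-identity for \<open>x * x\<close> into that for the
  self-adjoint element \<open>st x * x\<close>.\<close>

lemma norm_square_normal:
  assumes "normal_elem st x"
  shows "norm (x * x) = (norm x)\<^sup>2"
proof -
  have "st (x * x) * (x * x) = (st x * x) * (st x * x)"
    using assms unfolding normal_elem_def st_mult by (metis mult.assoc)
  also have "\<dots> = st (st x * x) * (st x * x)"
    by (simp add: st_mult)
  finally have "(norm (x * x))\<^sup>2 = ((norm x)\<^sup>2)\<^sup>2"
    by (metis norm_st_mult)
  then show ?thesis by (rule power2_eq_imp_eq) auto
qed

lemma normal_square:
  assumes "normal_elem st x"
  shows "normal_elem st (x * x)"
proof -
  have c: "st x * x = x * st x" using assms by (simp add: normal_elem_def)
  have "st x * (x * y) = x * (st x * y)" for y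
    by (simp add: c flip: mult.assoc)
  then show ?thesis by (simp add: normal_elem_def st_mult mult.assoc c)
qed

lemma normal_power2:
  assumes "normal_elem st x"
  shows "normal_elem st (x ^ 2 ^ m) \<and> norm (x ^ 2 ^ m) = norm x ^ 2 ^ m"
proof (induction m)
  case (Suc m)
  have eq: "x ^ 2 ^ Suc m = x ^ 2 ^ m * x ^ 2 ^ m" by (simp add: mult_2 flip: power_add)
  have "norm (x ^ 2 ^ m * x ^ 2 ^ m) = (norm x ^ 2 ^ m)\<^sup>2"
    using norm_square_normal[of "x ^ 2 ^ m"] Suc by simp
  also have "\<dots> = norm x ^ 2 ^ Suc m"
    by (simp add: power_even_eq)
  finally show ?case
    unfolding eq using Suc normal_square by blast
qed (use assms in simp)

lemma normal_norm_attained_in_spec: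
  assumes "normal_elem st x"
  shows "\<exists>z\<in>spec_elem sc x. cmod z = norm x"
  by (rule norm_attained_in_spec) (rule conjunct2[OF normal_power2[OF assms]])

text \<open>\<open>poly_eval_commute\<close> is applied twice: first to \<open>st x\<close>, then,
  after taking adjoints, to \<open>st (poly_eval sc p x)\<close>.\<close>

lemma normal_poly_eval:
  assumes "normal_elem st x"
  shows "normal_elem st (poly_eval sc p x)"
proof -
  have c1: "st x * poly_eval sc p x = poly_eval sc p x * st x"
    by (rule poly_eval_commute) (use assms in \<open>simp add: normal_elem_def\<close>)
  have "st (poly_eval sc p x) * x = x * st (poly_eval sc p x)" 
    using arg_cong[OF c1, of st] by (simp add: st_mult)
  then have "st (poly_eval sc p x) * poly_eval sc p x = poly_eval sc p x * st (poly_eval sc p x)"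
    by (rule poly_eval_commute)
  then show ?thesis by (simp add: normal_elem_def)
qed

lemma normal_norm_poly_eval:
  assumes "normal_elem st x"
  shows "\<exists>a\<in>spec_elem sc x. norm (poly_eval sc p x) = cmod (poly p a)"
proof -
  obtain z where z: "z \<in> spec_elem sc (poly_eval sc p x)" "cmod z = norm (poly_eval sc p x)"
    using normal_norm_attained_in_spec[OF normal_poly_eval[OF assms]] by blast
  moreover have "spec_elem sc x \<noteq> {}" using normal_norm_attained_in_spec[OF assms] by blast
  ultimately show ?thesis using spec_poly_eval by (metis (no_types))
qed

lemma spec_affine:
  assumes "z \<in> spec_elem sc x" "c \<noteq> 0"
  shows "1 + c * z \<in> spec_elem sc (1 + sc c x)"
proof -
  have "1 + sc c x - sc (1 + c * z) 1 = sc c (x - sc z 1)"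
    by (simp add: sc_add_left sc_diff_right)
  then show ?thesis using assms by (simp add: spec_elem_def invertible_sc)
qed

text \<open>A spectral point \<open>z\<close> with modulus \<open>norm D\<close> is shown to vanish.
  First-order growth of |1 + t z| rules out a real part; the C*-identity for 1 + i t D rules out an
  imaginary part.\<close>

lemma self_adjoint_small_perturbation_zero:
  assumes D: "st D = D" and C: "C \<ge> 0" "\<And>t. norm (1 + t *\<^sub>R D) \<le> 1 + C * t\<^sup>2"
  shows "D = 0"
proof -
  have "normal_elem st D" by (simp add: normal_elem_def D)
  then obtain z where z: "z \<in> spec_elem sc D" "cmod z = norm D"
    using normal_norm_attained_in_spec by blast
  have "Re z = 0"
  proof (rule linear_le_quadratic_imp_zero[OF C(1)])
    fix t :: real
    show "t * Re z \<le> C * t\<^sup>2"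
    proof (cases "t = 0")
      case False
      have "1 + t * Re z \<le> cmod (1 + of_real t * z)"
        using complex_Re_le_cmod[of "1 + of_real t * z"] by simp
      also have "\<dots> \<le> norm (1 + sc (of_real t) D)"
        by (intro spec_elem_norm_le spec_affine z) (use False in simp)
      also have "\<dots> \<le> 1 + C * t\<^sup>2" using C(2) by (simp add: sc_of_real)
      finally show ?thesis by simp
    qed simp
  qed
  moreover have "- 2 * Im z = 0"
  proof (rule linear_le_quadratic_imp_zero[of "(norm D)\<^sup>2"])
    fix t :: real
    show "t * (- 2 * Im z) \<le> (norm D)\<^sup>2 * t\<^sup>2"
    proof (cases "t = 0")
      case False
      define w where "w = 1 + sc (\<i> * of_real t) D"
      have "st w * w = 1 + (t\<^sup>2) *\<^sub>R (D * D)"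
      proof -
        have diff_sq: "(1 - X) * (1 + X) = 1 - X * X" for X :: 'a by (simp add: algebra_simps)
        have st_w: "st w = 1 - sc (\<i> * of_real t) D"
          by (simp add: w_def st_add st_sc D sc_minus_left)
        have "st w * w = 1 - sc (\<i> * of_real t) D * sc (\<i> * of_real t) D"
          unfolding st_w unfolding w_def by (rule diff_sq)
        also have "sc (\<i> * of_real t) D * sc (\<i> * of_real t) D = sc (of_real (- (t\<^sup>2))) (D * D)"
          by (simp add: sc_mult_left sc_mult_right power2_eq_square algebra_simps)
        finally show ?thesis unfolding sc_of_real by simp
      qed
      then have "(norm w)\<^sup>2 \<le> 1 + t\<^sup>2 * norm (D * D)"
        using norm_st_mult[of w] norm_triangle_ineq[of 1 "(t\<^sup>2) *\<^sub>R (D * D)"] by simp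
      then have w: "(norm w)\<^sup>2 \<le> 1 + t\<^sup>2 * (norm D)\<^sup>2"
        using norm_square_normal[OF \<open>normal_elem st D\<close>] by simp
      have "cmod (1 + \<i> * of_real t * z) \<le> norm w"
        unfolding w_def by (intro spec_elem_norm_le spec_affine z) (use False in simp)
      then have "(cmod (1 + \<i> * of_real t * z))\<^sup>2 \<le> (norm w)\<^sup>2" by (intro power_mono) auto
      moreover have "(cmod (1 + \<i> * of_real t * z))\<^sup>2 = (1 - t * Im z)\<^sup>2 + (t * Re z)\<^sup>2"
        by (simp add: cmod_power2)
      moreover have "(1 - t * Im z)\<^sup>2 = 1 - 2 * (t * Im z) + (t * Im z)\<^sup>2"
        by (simp add: power2_eq_square algebra_simps)
      ultimately have "1 - 2 * (t * Im z) \<le> 1 + t\<^sup>2 * (norm D)\<^sup>2"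
        using w zero_le_power2[of "t * Im z"] zero_le_power2[of "t * Re z"] by linarith
      then show ?thesis by (simp add: mult_ac)
    qed simp
  qed simp
  ultimately have "z = 0" by (simp add: complex_eq_iff)
  then show ?thesis using z(2) by simp
qed

lemma self_adjointI:
  assumes C: "C \<ge> 0" "\<And>t. (norm (1 + sc (\<i> * of_real t) T))\<^sup>2 \<le> 1 + C * t\<^sup>2"
  shows "st T = T"
proof -
  define D where "D = sc \<i> (T - st T)"
  have "D = 0"
  proof (rule self_adjoint_small_perturbation_zero[of D "C + norm (st T * T)"])
    show "st D = D" by (simp add: D_def st_sc st_diff sc_diff_right sc_minus_left)
    show "C + norm (st T * T) \<ge> 0" using C(1) by simp
    fix t :: real
    define w where "w = 1 + sc (\<i> * of_real t) T"
    have "st w * w = (1 + t *\<^sub>R D) + (t\<^sup>2) *\<^sub>R (st T * T)"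
      unfolding w_def st_add st_sc D_def
      by (simp add: algebra_simps sc_mult_left sc_mult_right sc_minus_left sc_diff_right power2_eq_square
          flip: sc_of_real)
    then have "1 + t *\<^sub>R D = st w * w - (t\<^sup>2) *\<^sub>R (st T * T)" by simp
    then have "norm (1 + t *\<^sub>R D) \<le> (norm w)\<^sup>2 + t\<^sup>2 * norm (st T * T)"
      using norm_triangle_ineq4[of "st w * w" "(t\<^sup>2) *\<^sub>R (st T * T)"] by (simp add: norm_st_mult)
    also have "\<dots> \<le> 1 + C * t\<^sup>2 + t\<^sup>2 * norm (st T * T)" using C(2)[of t] by (simp add: w_def)
    finally show "norm (1 + t *\<^sub>R D) \<le> 1 + (C + norm (st T * T)) * t\<^sup>2"
      by (simp add: algebra_simps)
  qed
  then have "sc (- \<i>) D = 0" by simp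
  then show ?thesis unfolding D_def by (simp add: eq_diff_eq)
qed

end

text \<open>For each n the norm passes to the first algebra, where it is |1 + i t q(a)| at a
  spectral point. Since h(a) is real, |1 + i t h(a)|^2 = 1 + t^2 h(a)^2 has no linear term; then n
  tends to infinity.\<close>

lemma norm_one_plus_sc_le:
  fixes scA :: "complex \<Rightarrow> 'a::{real_normed_algebra_1,banach} \<Rightarrow> 'a"
    and scB :: "complex \<Rightarrow> 'b::{real_normed_algebra_1,banach} \<Rightarrow> 'b"
  assumes A: "cstar_algebra scA stA" and B: "cstar_algebra scB stB" and N: "normal_elem stA N"
    and eq: "\<And>p. norm (poly_eval scA p N) = norm (poly_eval scB p A)"
    and lim: "(\<lambda>n. poly_eval scB (q n) A) \<longlonglongrightarrow> T"
    and \<delta>: "\<delta> \<longlonglongrightarrow> 0" and q: "\<And>n z. z \<in> spec_elem scA N \<Longrightarrow> cmod (h z - poly (q n) z) \<le> \<delta> n"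
    and h: "\<And>z. z \<in> spec_elem scA N \<Longrightarrow> h z \<in> \<real> \<and> (cmod (h z))\<^sup>2 \<le> C"
  shows "(norm (1 + scB (\<i> * of_real t) T))\<^sup>2 \<le> 1 + C * t\<^sup>2"
proof -
  interpret A: cstar_algebra scA stA by fact
  interpret B: cstar_algebra scB stB by fact
  let ?c = "\<i> * of_real t"
  have "norm (1 + scB ?c (poly_eval scB (q n) A)) \<le> sqrt (1 + C * t\<^sup>2) + \<bar>t\<bar> * \<delta> n" for n
  proof -
    have "1 + scB ?c (poly_eval scB (q n) A) = poly_eval scB ([:1:] + smult ?c (q n)) A"
      by (simp only: B.poly_eval_add B.poly_eval_smult B.poly_eval_pCons) simp
    then have "norm (1 + scB ?c (poly_eval scB (q n) A)) = norm (poly_eval scA ([:1:] + smult ?c (q n)) N)"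
      by (simp only: eq)
    also obtain a where a: "a \<in> spec_elem scA N"
      and "\<dots> = cmod (poly ([:1:] + smult ?c (q n)) a)"
      using A.normal_norm_poly_eval[OF N] by blast
    note this(2)
    also have "poly ([:1:] + smult ?c (q n)) a = (1 + ?c * h a) - ?c * (h a - poly (q n) a)"
      by (simp add: algebra_simps)
    also have "cmod \<dots> \<le> cmod (1 + ?c * h a) + \<bar>t\<bar> * cmod (h a - poly (q n) a)"
      using norm_triangle_ineq4[of "1 + ?c * h a" "?c * (h a - poly (q n) a)"] by (simp add: norm_mult)
    also have "cmod (1 + ?c * h a) \<le> sqrt (1 + C * t\<^sup>2)"
    proof (rule real_le_rsqrt)
      obtain r where r: "h a = of_real r" using h[OF a] by (auto elim: Reals_cases)
      have "r\<^sup>2 \<le> C" using h[OF a] by (simp add: r)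
      then have "r\<^sup>2 * t\<^sup>2 \<le> C * t\<^sup>2" by (intro mult_right_mono) auto
      then show "(cmod (1 + ?c * h a))\<^sup>2 \<le> 1 + C * t\<^sup>2"
        by (simp add: r cmod_power2 power_mult_distrib mult.commute)
    qed
    also have "\<bar>t\<bar> * cmod (h a - poly (q n) a) \<le> \<bar>t\<bar> * \<delta> n"
      by (intro mult_left_mono q a) auto
    finally show ?thesis by simp
  qed
  moreover have "(\<lambda>n. norm (1 + scB ?c (poly_eval scB (q n) A))) \<longlonglongrightarrow> norm (1 + scB ?c T)"
    by (intro tendsto_intros B.tendsto_sc lim)
  moreover have "(\<lambda>n. sqrt (1 + C * t\<^sup>2) + \<bar>t\<bar> * \<delta> n) \<longlonglongrightarrow> sqrt (1 + C * t\<^sup>2) + \<bar>t\<bar> * 0"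
    by (intro tendsto_intros \<delta>)
  ultimately have le: "norm (1 + scB ?c T) \<le> sqrt (1 + C * t\<^sup>2)"
    using LIMSEQ_le[of "\<lambda>n. norm (1 + scB ?c (poly_eval scB (q n) A))" _
      "\<lambda>n. sqrt (1 + C * t\<^sup>2) + \<bar>t\<bar> * \<delta> n"] by auto
  then have "(norm (1 + scB ?c T))\<^sup>2 \<le> (sqrt (1 + C * t\<^sup>2))\<^sup>2" by (intro power_mono) auto
  \<comment> \<open>\<open>sqrt\<close> is negative on negative reals, so the bound just proved
    shows that the radicand is nonnegative.\<close>
  moreover have "1 + C * t\<^sup>2 \<ge> 0" using order_trans[OF norm_ge_zero le] by simp
  ultimately show ?thesis by simp
qed

theorem theorem3p2:
  fixes scA :: "complex \<Rightarrow> 'a::{real_normed_algebra_1,banach} \<Rightarrow> 'a"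
    and stA :: "'a \<Rightarrow> 'a"
    and scB :: "complex \<Rightarrow> 'b::{real_normed_algebra_1,banach} \<Rightarrow> 'b"
    and stB :: "'b \<Rightarrow> 'b"
    and N :: 'a and A :: 'b
  assumes "unital_cstar_algebra scA stA"
    and "unital_cstar_algebra scB stB"
    and "normal_elem stA N"
    and "lavrentieff (spec_elem scA N)"
    and "\<forall>p. norm (poly_eval scA p N) = norm (poly_eval scB p A)"
  shows "normal_elem stB A"
proof -
  have locs: "cstar_algebra scA stA" "cstar_algebra scB stB" using assms(1,2) by unfold_locales
  interpret A: cstar_algebra scA stA by fact
  interpret B: cstar_algebra scB stB by fact
  define K where "K = spec_elem scA N"
  have K: "compact K" "connected (- K)" "interior K = {}"
    using assms(4) by (auto simp: K_def lavrentieff_def)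
  have eq: "\<And>p. norm (poly_eval scA p N) = norm (poly_eval scB p A)" using assms(5) by blast
  define \<delta> where "\<delta> n = inverse (real (Suc n))" for n
  have \<delta>: "\<delta> n > 0" "\<delta> \<longlonglongrightarrow> 0" for n
    unfolding \<delta>_def by (simp, rule LIMSEQ_inverse_real_of_nat)
  have "\<exists>p. \<forall>z\<in>K. cmod (cnj z - poly p z) < \<delta> n" for n
    using cnj_in_poly_closure[OF K] \<delta>(1) by (auto simp: poly_closure_def)
  then obtain p where p: "\<And>n z. z \<in> K \<Longrightarrow> cmod (cnj z - poly (p n) z) < \<delta> n" by metis
  define P where "P n = poly_eval scB (p n) A" for n
  \<comment> \<open>Differences have the same norm when evaluated at \<open>N\<close>, where
    normality reduces them to one point of \<open>K\<close>.\<close>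
  have dist: "dist (P m) (P n) \<le> \<delta> m + \<delta> n" for m n
  proof -
    obtain a where a: "a \<in> K" "norm (poly_eval scA (p m - p n) N) = cmod (poly (p m - p n) a)"
      using A.normal_norm_poly_eval[OF assms(3)] unfolding K_def by blast
    have "dist (P m) (P n) = cmod (poly (p m - p n) a)"
      unfolding dist_norm P_def by (simp only: B.poly_eval_diff[symmetric] eq[symmetric] a)
    also have "\<dots> = cmod ((cnj a - poly (p n) a) - (cnj a - poly (p m) a))" by simp
    also have "\<dots> \<le> \<delta> n + \<delta> m"
      using norm_triangle_ineq4[of "cnj a - poly (p n) a" "cnj a - poly (p m) a"] p[OF a(1), of n] p[OF a(1), of m]
      by linarith
    finally show ?thesis by simp
  qed
  have "Cauchy P"
  proof (rule metric_CauchyI)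
    fix e :: real assume "e > 0"
    then have "\<forall>\<^sub>F n in sequentially. \<delta> n < e/2" using \<delta>(2) by (intro order_tendstoD) auto
    then obtain M where M: "\<And>n. n \<ge> M \<Longrightarrow> \<delta> n < e/2" by (auto simp: eventually_sequentially)
    show "\<exists>M. \<forall>m\<ge>M. \<forall>n\<ge>M. dist (P m) (P n) < e"
    proof (intro exI[of _ M] allI impI)
      fix m n assume "m \<ge> M" "n \<ge> M"
      then show "dist (P m) (P n) < e" using dist[of m n] M[of m] M[of n] by linarith
    qed
  qed
  then obtain B where B: "P \<longlonglongrightarrow> B" using Cauchy_convergent_iff convergent_def by blast
  obtain R where R: "R > 0" "\<And>z. z \<in> K \<Longrightarrow> cmod z \<le> R"
    using compact_imp_bounded[OF K(1)] unfolding bounded_pos by auto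
  have lim\<^sub>1: "(\<lambda>n. poly_eval scB ([:0, 1:] + p n) A) \<longlonglongrightarrow> A + B"
    using tendsto_add[OF tendsto_const B, of A]
    by (simp add: B.poly_eval_add B.poly_eval_pCons P_def del: add_pCons)
  have lim\<^sub>2: "(\<lambda>n. poly_eval scB (smult \<i> (p n - [:0, 1:])) A) \<longlonglongrightarrow> scB \<i> (B - A)"
  proof -
    have "(\<lambda>n. scB \<i> (P n - A)) \<longlonglongrightarrow> scB \<i> (B - A)"
      by (intro B.tendsto_sc tendsto_intros B)
    then show ?thesis
      by (simp add: B.poly_eval_smult B.poly_eval_diff B.poly_eval_pCons P_def del: diff_pCons)
  qed
  \<comment> \<open>The function behind \<open>A + B\<close> on \<open>K\<close> is z + cnj z = 2 Re
    z.\<close>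
  have "stB (A + B) = A + B"
  proof (rule B.self_adjointI)
    show "(norm (1 + scB (\<i> * of_real t) (A + B)))\<^sup>2 \<le> 1 + (2 * R)\<^sup>2 * t\<^sup>2" for t
    proof (rule norm_one_plus_sc_le[OF locs assms(3) eq lim\<^sub>1 \<delta>(2)])
      fix n z assume z: "z \<in> spec_elem scA N"
      have "z + cnj z - poly ([:0, 1:] + p n) z = cnj z - poly (p n) z" by simp
      then show "cmod (z + cnj z - poly ([:0, 1:] + p n) z) \<le> \<delta> n"
        using p[of z n] z by (simp only: K_def less_imp_le)
    next
      fix z assume z: "z \<in> spec_elem scA N"
      have "cmod (z + cnj z) \<le> 2 * R" using norm_triangle_ineq[of z "cnj z"] R(2)[of z] z by (simp add: K_def)
      then show "z + cnj z \<in> \<real> \<and> (cmod (z + cnj z))\<^sup>2 \<le> (2 * R)\<^sup>2"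
        by (intro conjI power_mono) (auto simp: complex_is_Real_iff)
    qed
  qed simp
  \<comment> \<open>The function behind this element is i (cnj z - z) = 2 Im z.\<close>
  moreover have "stB (scB \<i> (B - A)) = scB \<i> (B - A)"
  proof (rule B.self_adjointI)
    show "(norm (1 + scB (\<i> * of_real t) (scB \<i> (B - A))))\<^sup>2 \<le> 1 + (2 * R)\<^sup>2 * t\<^sup>2" for t
    proof (rule norm_one_plus_sc_le[OF locs assms(3) eq lim\<^sub>2 \<delta>(2)])
      fix n z assume z: "z \<in> spec_elem scA N"
      have "\<i> * (cnj z - z) - poly (smult \<i> (p n - [:0, 1:])) z = \<i> * (cnj z - poly (p n) z)"
        by (simp add: algebra_simps)
      then show "cmod (\<i> * (cnj z - z) - poly (smult \<i> (p n - [:0, 1:])) z) \<le> \<delta> n"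
        using p[of z n] z by (simp add: K_def norm_mult)
    next
      fix z assume z: "z \<in> spec_elem scA N"
      have "cmod (\<i> * (cnj z - z)) \<le> 2 * R"
        using norm_triangle_ineq4[of "cnj z" z] R(2)[of z] z by (simp add: K_def norm_mult)
      then show "\<i> * (cnj z - z) \<in> \<real> \<and> (cmod (\<i> * (cnj z - z)))\<^sup>2 \<le> (2 * R)\<^sup>2"
        by (intro conjI power_mono) (auto simp: complex_is_Real_iff)
    qed
  qed simp
  then have "scB (- \<i>) (scB (- \<i>) (stB B - stB A)) = scB (- \<i>) (scB \<i> (B - A))"
    by (simp add: B.st_sc B.st_diff)
  then have "stB A - stB B = B - A" by (simp add: B.sc_minus_left B.sc_minus_right)
  ultimately have "stB A + stB B = A + B" "stB A - stB B = B - A" by (simp_all add: B.st_add)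
  then have "(stB A + stB B) + (stB A - stB B) = (A + B) + (B - A)" by simp
  then have "2 *\<^sub>R stB A = 2 *\<^sub>R B" by (simp add: scaleR_2)
  then have stA: "stB A = B" by simp
  \<comment> \<open>The adjoint \<open>B\<close> is a limit of polynomials in \<open>A\<close>,
    hence commutes with \<open>A\<close>.\<close>
  have comm: "P n * A = A * P n" for n
    unfolding P_def using B.poly_eval_commute[of A A "p n"] by simp
  have "(\<lambda>n. P n * A) \<longlonglongrightarrow> B * A" "(\<lambda>n. A * P n) \<longlonglongrightarrow> A * B"
    by (intro tendsto_intros B)+
  then have "B * A = A * B" unfolding comm using LIMSEQ_unique by blast
  then show ?thesis by (simp add: normal_elem_def stA)
qed

end
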